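(* Let $p$ be a prime number. Let $A$ and $B$ be groups, $H\leqslant A$ and $K\leqslant B$ subgroups, $\varphi: H\to K$ an isomorphism, and let $G=(A*B;\,H=K,\varphi)$ be the free product of $A$ and $B$ with $H$ and $K$ amalgamated according to $\varphi$. Let $\Omega_A^p$ (resp. $\Omega_B^p$) be the family of all subgroups $A\cap N$ (resp. $B\cap N$), where $N$ ranges over the normal subgroups of $G$ of finite $p$-index. Suppose that $\Omega_A^p$ is an $H$-filtration and $\Omega_B^p$ is a $K$-filtration. Then every $p'$-isolated cyclic subgroup of $G$ that is not conjugate in $G$ to any subgroup of the family $\Lambda_A^p\cup\Lambda_B^p$ is $p$-separable in $G$.
   Context: A subgroup of finite $p$-index is a subgroup whose index is a (finite) power of $p$, $p^0=1$ allowed. A subgroup $F$ of a group $X$ is $p$-separable in $X$ if for every $g\in X\setminus F$ there is a homomorphism $\psi$ of $X$ onto a finite $p$-group with $g\psi\notin F\psi$. A subgroup $Y$ of a group $X$ is $p'$-isolated (in $X$) if for every $g\in X$ and every prime $q\neq p$, $g^q\in Y$ implies $g\in Y$. For a family $\Psi$ of normal subgroups of $X$, a subgroup $F\leqslant X$ is separable by the subgroups of $\Psi$ if $\bigcap_{N\in\Psi}FN=F$. For a subgroup $Y\leqslant X$, the family $\Psi$ is a $Y$-filtration if $\bigcap_{N\in\Psi}N=1$ and $Y$ is separable by the subgroups of $\Psi$. $\Lambda_A^p$ (resp. $\Lambda_B^p$) is the family of all cyclic subgroups of $A$ (resp. $B$) that are $p'$-isolated in $A$ (resp. $B$) and are not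 separable by the subgroups of $\Omega_A^p$ (resp. $\Omega_B^p$). *)

theory Defs
  imports "HOL-Algebra.Generated_Groups" "HOL-Computational_Algebra.Primes"
begin

section \<open>Free products with amalgamation\<close>

text \<open>
  The free product of \<open>A\<close> and \<open>B\<close> with \<open>H\<close> amalgamated along \<open>\<phi>\<close> is the group presented by the
  disjoint union of the carriers, the multiplication tables of \<open>A\<close> and \<open>B\<close>, and the relations
  \<open>h = \<phi> h\<close> for \<open>h \<in> H\<close>. It is realised as the monoid of words over the disjoint union modulo the
  congruence generated by these relations; inverse letters are not needed, since every letter
  is invertible modulo the congruence.
\<close>

definition amalg_words :: "('a, 'm) monoid_scheme \<Rightarrow> ('b, 'n) monoid_scheme \<Rightarrow> ('a + 'b) list set" where
  "amalg_words A B = lists (carrier A <+> carrier B)"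

inductive amalg_eq ::
  "('a, 'm) monoid_scheme \<Rightarrow> ('b, 'n) monoid_scheme \<Rightarrow> 'a set \<Rightarrow> ('a \<Rightarrow> 'b)
    \<Rightarrow> ('a + 'b) list \<Rightarrow> ('a + 'b) list \<Rightarrow> bool"
  for A (structure) and B (structure) and H and \<phi> where
  refl: "w \<in> amalg_words A B \<Longrightarrow> amalg_eq A B H \<phi> w w"
| sym: "amalg_eq A B H \<phi> v w \<Longrightarrow> amalg_eq A B H \<phi> w v"
| trans: "amalg_eq A B H \<phi> u v \<Longrightarrow> amalg_eq A B H \<phi> v w \<Longrightarrow> amalg_eq A B H \<phi> u w"
| append: "amalg_eq A B H \<phi> v v' \<Longrightarrow> amalg_eq A B H \<phi> w w' \<Longrightarrow> amalg_eq A B H \<phi> (v @ w) (v' @ w')"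
| left_mult: "a \<in> carrier A \<Longrightarrow> a' \<in> carrier A
    \<Longrightarrow> amalg_eq A B H \<phi> [Inl a, Inl a'] [Inl (a \<otimes>\<^bsub>A\<^esub> a')]"
| left_one: "amalg_eq A B H \<phi> [Inl \<one>\<^bsub>A\<^esub>] []"
| right_mult: "b \<in> carrier B \<Longrightarrow> b' \<in> carrier B
    \<Longrightarrow> amalg_eq A B H \<phi> [Inr b, Inr b'] [Inr (b \<otimes>\<^bsub>B\<^esub> b')]"
| right_one: "amalg_eq A B H \<phi> [Inr \<one>\<^bsub>B\<^esub>] []"
| amalg: "h \<in> H \<Longrightarrow> amalg_eq A B H \<phi> [Inl h] [Inr (\<phi> h)]"

definition amalg_rel ::
  "('a, 'm) monoid_scheme \<Rightarrow> ('b, 'n) monoid_scheme \<Rightarrow> 'a set \<Rightarrow> ('a \<Rightarrow> 'b)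
    \<Rightarrow> (('a + 'b) list \<times> ('a + 'b) list) set" where
  "amalg_rel A B H \<phi> = {(v, w). amalg_eq A B H \<phi> v w}"

definition amalg_product ::
  "('a, 'm) monoid_scheme \<Rightarrow> ('b, 'n) monoid_scheme \<Rightarrow> 'a set \<Rightarrow> ('a \<Rightarrow> 'b)
    \<Rightarrow> ('a + 'b) list set monoid" where
  "amalg_product A B H \<phi> =
    \<lparr>carrier = amalg_words A B // amalg_rel A B H \<phi>,
     monoid.mult = (\<lambda>X Y. \<Union>x\<in>X. \<Union>y\<in>Y. amalg_rel A B H \<phi> `` {x @ y}),
     one = amalg_rel A B H \<phi> `` {[]}\<rparr>"

text \<open>The canonical maps of the factors into the product. They are injective, and \<open>A\<close>, \<open>B\<close> are
  identified with their images.\<close>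

definition amalg_inl ::
  "('a, 'm) monoid_scheme \<Rightarrow> ('b, 'n) monoid_scheme \<Rightarrow> 'a set \<Rightarrow> ('a \<Rightarrow> 'b)
    \<Rightarrow> 'a \<Rightarrow> ('a + 'b) list set" where
  "amalg_inl A B H \<phi> a = amalg_rel A B H \<phi> `` {[Inl a]}"

definition amalg_inr ::
  "('a, 'm) monoid_scheme \<Rightarrow> ('b, 'n) monoid_scheme \<Rightarrow> 'a set \<Rightarrow> ('a \<Rightarrow> 'b)
    \<Rightarrow> 'b \<Rightarrow> ('a + 'b) list set" where
  "amalg_inr A B H \<phi> b = amalg_rel A B H \<phi> `` {[Inr b]}"

section \<open>Separability\<close>

definition finite_p_index :: "nat \<Rightarrow> ('a, 'm) monoid_scheme \<Rightarrow> 'a set \<Rightarrow> bool" where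
  "finite_p_index p X N \<longleftrightarrow>
    subgroup N X \<and> finite (rcosets\<^bsub>X\<^esub> N) \<and> (\<exists>n. card (rcosets\<^bsub>X\<^esub> N) = p ^ n)"

definition finite_p_group :: "nat \<Rightarrow> ('a, 'm) monoid_scheme \<Rightarrow> bool" where
  "finite_p_group p P \<longleftrightarrow> group P \<and> finite (carrier P) \<and> (\<exists>n. order P = p ^ n)"

text \<open>Every finite group has an isomorphic copy with carrier in the natural numbers, so taking
  the target \<open>P\<close> of this type is no restriction.\<close>

definition p_separable :: "nat \<Rightarrow> ('a, 'm) monoid_scheme \<Rightarrow> 'a set \<Rightarrow> bool" where
  "p_separable p X F \<longleftrightarrow> subgroup F X \<and>
    (\<forall>g \<in> carrier X - F. \<exists>(P :: nat monoid) \<psi>.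
      finite_p_group p P \<and> \<psi> \<in> epi X P \<and> \<psi> g \<notin> \<psi> ` F)"

definition p'_isolated :: "nat \<Rightarrow> ('a, 'm) monoid_scheme \<Rightarrow> 'a set \<Rightarrow> bool" where
  "p'_isolated p X Y \<longleftrightarrow> subgroup Y X \<and>
    (\<forall>g \<in> carrier X. \<forall>q :: nat. prime q \<and> q \<noteq> p \<and> g [^]\<^bsub>X\<^esub> q \<in> Y \<longrightarrow> g \<in> Y)"

text \<open>Intersections are taken inside \<open>X\<close>: the intersection of the empty family is \<open>X\<close>.\<close>

definition separable_by :: "('a, 'm) monoid_scheme \<Rightarrow> 'a set set \<Rightarrow> 'a set \<Rightarrow> bool" where
  "separable_by X \<Psi> F \<longleftrightarrow> carrier X \<inter> (\<Inter>N\<in>\<Psi>. F <#>\<^bsub>X\<^esub> N) = F"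

definition filtration :: "('a, 'm) monoid_scheme \<Rightarrow> 'a set \<Rightarrow> 'a set set \<Rightarrow> bool" where
  "filtration X Y \<Psi> \<longleftrightarrow> subgroup Y X \<and> (\<forall>N\<in>\<Psi>. N \<lhd> X) \<and>
    carrier X \<inter> \<Inter>\<Psi> = {\<one>\<^bsub>X\<^esub>} \<and> separable_by X \<Psi> Y"

definition cyclic_subgroup :: "('a, 'm) monoid_scheme \<Rightarrow> 'a set \<Rightarrow> bool" where
  "cyclic_subgroup X C \<longleftrightarrow> (\<exists>x \<in> carrier X. C = generate X {x})"

definition conjugate_in :: "('a, 'm) monoid_scheme \<Rightarrow> 'a set \<Rightarrow> 'a set \<Rightarrow> bool" where
  "conjugate_in X U V \<longleftrightarrow> (\<exists>g \<in> carrier X. V = g <#\<^bsub>X\<^esub> (U #>\<^bsub>X\<^esub> inv\<^bsub>X\<^esub> g))"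

section \<open>The families of subgroups of the factors\<close>

text \<open>For a group \<open>X\<close> embedded in \<open>G\<close> by \<open>\<iota>\<close>, the intersection of \<open>X\<close> with a subgroup \<open>N\<close>
  of \<open>G\<close> is, as a subset of \<open>X\<close>, the preimage of \<open>N\<close> under \<open>\<iota>\<close>.\<close>

definition Omega ::
  "nat \<Rightarrow> ('g, 'k) monoid_scheme \<Rightarrow> ('a \<Rightarrow> 'g) \<Rightarrow> ('a, 'm) monoid_scheme \<Rightarrow> 'a set set" where
  "Omega p G \<iota> X = {{x \<in> carrier X. \<iota> x \<in> N} | N. N \<lhd> G \<and> finite_p_index p G N}"

definition Lambda ::
  "nat \<Rightarrow> ('g, 'k) monoid_scheme \<Rightarrow> ('a \<Rightarrow> 'g) \<Rightarrow> ('a, 'm) monoid_scheme \<Rightarrow> 'a set set" where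
  "Lambda p G \<iota> X =
    {L. cyclic_subgroup X L \<and> p'_isolated p X L \<and> \<not> separable_by X (Omega p G \<iota> X) L}"

end

theory Submission
  imports Defs "HOL-Algebra.Multiplicative_Group" "HOL-Algebra.Sylow" "HOL-Algebra.Zassenhaus"
begin

text \<open>
  Write \<open>X True\<close> and \<open>X False\<close> for the images of \<open>A\<close> and \<open>B\<close> in \<open>G\<close>, and \<open>H\<close> for their common
  subgroup. An element \<open>g\<close> is separated from the cyclic subgroup \<open>C\<close> by a finite \<open>p\<close>-quotient iff
  \<open>g \<notin> C N\<close> for some normal subgroup \<open>N\<close> of finite \<open>p\<close>-index, so everything is about finding such
  \<open>N\<close>.

  The tool is the cocycle on \<open>G\<close> that sends \<open>g\<close> to the signed sum of the edges on the path from a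
  base vertex to its translate by \<open>g\<close> in the Bass--Serre tree. It can be computed letter by letter,
  and its edges may be read modulo any subgroup \<open>E\<close> that contains \<open>H\<close>.
  Take \<open>E = H N\<close> with \<open>N\<close> of finite \<open>p\<close>-index. Reduced modulo \<open>p\<close> and restricted to \<open>N\<close>, the
  cocycle is a homomorphism into a finite elementary abelian \<open>p\<close>-group; its kernel \<open>N'\<close> is again
  normal of finite \<open>p\<close>-index and has the same intersections with the factors as \<open>N\<close>
  (\<open>refine_by_cocycle\<close>). Passing from \<open>N\<close> to \<open>N'\<close> replaces the finite graph \<open>tree / N\<close> by its
  covering that belongs to homology modulo \<open>p\<close>, in which every simple closed path opens up. Hence
  after finitely many passages a given reduced word whose letters avoid \<open>H N\<close> traces a path without
  repeated edges (\<open>separate_partial_products\<close>). It follows that elements outside a factor are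
  separated from that factor, that \<open>G\<close> is residually a finite \<open>p\<close>-group, and that the orders of a cyclically reduced
  element of positive even length are unbounded modulo the subgroups with prescribed intersections
  with the factors, once these intersections are small enough. By contrast the order of an
  element conjugate into a factor is bounded as soon as those intersections are fixed.

  Let \<open>C\<close> be generated by \<open>c\<close>. If \<open>c\<close> is conjugate to an element \<open>a\<close> of a factor, then the subgroup
  generated by \<open>a\<close> is not in the family \<open>\<Lambda>\<close>, so it is separated from the other elements of the
  factor; the elements outside the factor are separated even from the whole factor.

  Otherwise \<open>c\<close> is conjugate to a cyclically reduced word of even length. An element \<open>g\<close> that does
  not commute with \<open>c\<close> is separated from \<open>C\<close> by any \<open>N\<close> that omits the commutator. If \<open>g\<close> commutes
  with \<open>c\<close>, it permutes the edges on the axis of \<open>c\<close>, which form finitely many orbits under \<open>c\<close>;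
  hence some \<open>x = g^m c^l\<close> with \<open>m > 0\<close> fixes an edge, and so has bounded order. For the least \<open>m\<close>
  with an \<open>x\<close> of bounded order, choose \<open>N\<close> modulo which the order of \<open>c\<close> is much larger than that of
  \<open>x\<close>. If \<open>g\<close> were congruent to \<open>c^i\<close>, then \<open>x\<close> would be congruent to \<open>c^j\<close> with \<open>j = i m + l\<close>, and \<open>j\<close>
  would be divisible by a high power of \<open>p\<close>. When \<open>p\<close> does not divide \<open>m\<close>, this makes \<open>x\<close> trivial
  in a quotient where, because \<open>C\<close> is \<open>p'\<close>-isolated, it could be chosen to survive. When \<open>p\<close>
  divides \<open>m\<close>, it also divides \<open>l\<close>, and the \<open>p\<close>-th root \<open>g^(m/p) c^(l/p)\<close> of \<open>x\<close> contradicts the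
  minimality of \<open>m\<close>.
\<close>

section \<open>Normal subgroups of finite p-index\<close>

definition normal_p_index :: "nat \<Rightarrow> ('a, 'm) monoid_scheme \<Rightarrow> 'a set \<Rightarrow> bool" where
  "normal_p_index p G N \<longleftrightarrow> N \<lhd> G \<and> finite_p_index p G N"

lemma prime_power_if_only_prime_divisor:
  fixes p n :: nat
  assumes "prime p" "n > 0" and only: "\<And>q. prime q \<Longrightarrow> q dvd n \<Longrightarrow> q = p"
  shows "\<exists>k. n = p ^ k"
proof -
  obtain m where m: "n = p ^ multiplicity p n * m" "\<not> p dvd m"
    using multiplicity_decompose'[of n p] assms by (metis not_prime_unit not_gr0)
  have "m = 1"
  proof (rule ccontr)
    assume "m \<noteq> 1"
    then obtain q where "prime q" "q dvd m"
      using prime_factor_nat by blast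
    with only m show False by (metis dvd_mult)
  qed
  with m show ?thesis by auto
qed

lemma (in group) order_p_power:
  fixes p :: nat
  assumes "prime p" and fin: "finite (carrier G)"
    and tors: "\<And>g. g \<in> carrier G \<Longrightarrow> \<exists>k. g [^] (p ^ k) = \<one>"
  shows "\<exists>n. order G = p ^ n"
proof (rule prime_power_if_only_prime_divisor)
  show "order G > 0" using fin by (simp add: order_gt_0_iff_finite)
  fix q :: nat assume q: "prime q" "q dvd order G"
  \<comment> \<open>Sylow's theorem with exponent 1 is Cauchy's theorem.\<close>
  obtain m where "order G = q ^ 1 * m" using q(2) by auto
  then obtain Q where Q: "subgroup Q G" "card Q = q"
    using sylow_thm[OF q(1) group_axioms _ fin] by (metis power_one_right)
  have "\<exists>x\<in>Q. x \<noteq> \<one>"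
  proof (rule ccontr)
    assume "\<not> ?thesis"
    then have "Q \<subseteq> {\<one>}" by auto
    then have "card Q \<le> 1" using card_mono[of "{\<one>}" Q] by simp
    with Q(2) prime_gt_1_nat[OF q(1)] show False by simp
  qed
  then obtain x where x: "x \<in> Q" "x \<noteq> \<one>" by blast
  have xG: "x \<in> carrier G" using x Q(1) subgroup.mem_carrier by metis
  interpret Q: group "G\<lparr>carrier := Q\<rparr>" using subgroup_imp_group[OF Q(1)] .
  have "x [^]\<^bsub>G\<lparr>carrier := Q\<rparr>\<^esub> q = \<one>"
    using Q.pow_order_eq_1[of x] x Q(2) by (simp add: order_def)
  then have "x [^] q = \<one>" using nat_pow_consistent by metis
  then have "ord x dvd q" using pow_eq_id[OF xG] by simp
  moreover obtain k where "ord x dvd p ^ k" using tors[OF xG] pow_eq_id[OF xG] by auto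
  moreover have "ord x \<noteq> 1" using ord_eq_1[OF xG] x by simp
  ultimately have "q dvd p ^ k" using q(1) by (metis prime_nat_iff)
  then show "q = p" using q(1) \<open>prime p\<close>
    using prime_dvd_power primes_dvd_imp_eq by blast
qed (fact \<open>prime p\<close>)

text \<open>Finite index is shown throughout by exhibiting an invariant of \<open>x\<close> with finitely many values that
  determines the coset of \<open>x\<close>.\<close>

lemma (in group) finite_rcosetsI:
  assumes N: "subgroup N G" and fin: "finite (f ` carrier G)"
    and sep: "\<And>x y. x \<in> carrier G \<Longrightarrow> y \<in> carrier G \<Longrightarrow> f x = f y \<Longrightarrow> x \<otimes> inv y \<in> N"
  shows "finite (rcosets N)"
proof -
  have "N #> x \<in> (\<lambda>v. N #> inv_into (carrier G) f v) ` (f ` carrier G)" if x: "x \<in> carrier G" for x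
  proof -
    let ?y = "inv_into (carrier G) f (f x)"
    have y: "?y \<in> carrier G" "f ?y = f x"
      using x by (auto intro: inv_into_into f_inv_into_f)
    then have "x \<otimes> inv ?y \<in> N" using sep[OF x y(1)] by simp
    then have "x \<in> N #> ?y" using x y(1) N
      by (metis group.rcosI inv_closed inv_solve_right m_assoc m_closed group_axioms l_inv r_one subgroup.subset)
    then have "N #> ?y = N #> x" using repr_independence[OF _ y(1) N] by blast
    then show ?thesis using x by blast
  qed
  then have "rcosets N \<subseteq> (\<lambda>v. N #> inv_into (carrier G) f v) ` (f ` carrier G)"
    unfolding RCOSETS_def by blast
  with fin show ?thesis by (meson finite_imageI finite_subset)
qed

lemma (in group) rcoset_eq_iff:
  assumes N: "subgroup N G" and x: "x \<in> carrier G" and y: "y \<in> carrier G"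
  shows "N #> x = N #> y \<longleftrightarrow> x \<otimes> inv y \<in> N"
proof
  assume "N #> x = N #> y"
  then have "x \<in> N #> y" using rcos_self[OF x N] by simp
  then obtain n where "n \<in> N" "x = n \<otimes> y" unfolding r_coset_def by blast
  then show "x \<otimes> inv y \<in> N" using y subgroup.mem_carrier[OF N] by (simp add: m_assoc)
next
  assume "x \<otimes> inv y \<in> N"
  then have "x \<in> N #> y" using x y N rcosI[of "x \<otimes> inv y" N y]
    by (simp add: m_assoc subgroup.subset)
  then show "N #> x = N #> y" using repr_independence[OF _ y N] by simp
qed

text \<open>Cauchy's theorem turns a cardinality condition on the quotient into a condition on powers
  of elements, which passes to intersections and to kernels without counting.\<close>

lemma (in group) normal_p_index_iff:
  fixes p :: nat
  assumes p: "prime p"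
  shows "normal_p_index p G N \<longleftrightarrow>
    N \<lhd> G \<and> finite (rcosets N) \<and> (\<forall>g\<in>carrier G. \<exists>k. g [^] (p ^ k) \<in> N)"
proof (cases "N \<lhd> G")
  case True
  then interpret N: normal N G .
  interpret Q: group "G Mod N" by (rule N.factorgroup_is_group)
  have sub: "subgroup N G" by (rule N.subgroup_axioms)
  have hom: "group_hom G (G Mod N) (\<lambda>x. N #> x)"
    using N.r_coset_hom_Mod by (simp add: group_hom_def group_hom_axioms_def group_axioms Q.group_axioms)
  have car: "carrier (G Mod N) = rcosets N" by (simp add: FactGroup_def)
  have pw: "(N #> g) [^]\<^bsub>G Mod N\<^esub> (k::nat) = \<one>\<^bsub>G Mod N\<^esub> \<longleftrightarrow> g [^] k \<in> N" if "g \<in> carrier G" for g k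
  proof -
    have "(N #> g) [^]\<^bsub>G Mod N\<^esub> k = N #> (g [^] k)"
      using group_hom.hom_nat_pow[OF hom that] by metis
    moreover have "\<one>\<^bsub>G Mod N\<^esub> = N" by (simp add: FactGroup_def)
    ultimately show ?thesis using coset_join1 coset_join2 that sub
      by (metis N.subset nat_pow_closed)
  qed
  show ?thesis
  proof
    assume "normal_p_index p G N"
    then obtain n where n: "finite (rcosets N)" "card (rcosets N) = p ^ n"
      unfolding normal_p_index_def finite_p_index_def by auto
    have "g [^] (p ^ n) \<in> N" if "g \<in> carrier G" for g
    proof -
      have "N #> g \<in> carrier (G Mod N)" using that car rcosetsI[OF N.subset] by simp
      then have "(N #> g) [^]\<^bsub>G Mod N\<^esub> (order (G Mod N)) = \<one>\<^bsub>G Mod N\<^esub>"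
        by (rule Q.pow_order_eq_1)
      then show ?thesis using pw[OF that] n(2) car by (simp add: order_def)
    qed
    with n True show "N \<lhd> G \<and> finite (rcosets N) \<and> (\<forall>g\<in>carrier G. \<exists>k. g [^] (p ^ k) \<in> N)" by blast
  next
    assume R: "N \<lhd> G \<and> finite (rcosets N) \<and> (\<forall>g\<in>carrier G. \<exists>k. g [^] (p ^ k) \<in> N)"
    have "\<exists>n. order (G Mod N) = p ^ n"
    proof (rule Q.order_p_power[OF p])
      show "finite (carrier (G Mod N))" using R car by simp
      fix c assume "c \<in> carrier (G Mod N)"
      then obtain g where g: "g \<in> carrier G" "c = N #> g" unfolding car RCOSETS_def by blast
      then show "\<exists>k. c [^]\<^bsub>G Mod N\<^esub> (p ^ k) = \<one>\<^bsub>G Mod N\<^esub>" using R pw by blast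
    qed
    then show "normal_p_index p G N"
      unfolding normal_p_index_def finite_p_index_def using R sub car by (simp add: order_def)
  qed
qed (simp add: normal_p_index_def)

context group
begin

lemma subgroup_nat_pow_closed:
  assumes "subgroup N G" "g \<in> N" shows "g [^] (k::nat) \<in> N"
  using subgroup_int_pow_closed[OF assms, of "int k"] by (simp add: int_pow_int)

lemma normal_p_index_normal: "normal_p_index p G N \<Longrightarrow> N \<lhd> G"
  by (simp add: normal_p_index_def)

lemma normal_p_index_carrier: "normal_p_index p G (carrier G)"
proof -
  have "rcosets (carrier G) = {carrier G}"
    unfolding RCOSETS_def using coset_join2[OF _ subgroup_self] one_closed by auto
  then show ?thesis unfolding normal_p_index_def finite_p_index_def
    using subgroup_self normal_inv_iff by (auto intro: exI[of _ 0])
qed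

lemma normal_p_index_Int:
  fixes p :: nat
  assumes p: "prime p" and M: "normal_p_index p G M" and N: "normal_p_index p G N"
  shows "normal_p_index p G (M \<inter> N)"
proof -
  note M' = M[unfolded normal_p_index_iff[OF p]] and N' = N[unfolded normal_p_index_iff[OF p]]
  have sM: "subgroup M G" and sN: "subgroup N G"
    using M' N' normal_imp_subgroup by blast+
  have nor: "M \<inter> N \<lhd> G" using M' N' normal_subgroup_intersect by blast
  have "finite (rcosets (M \<inter> N))"
  proof (rule finite_rcosetsI[where f = "\<lambda>x. (M #> x, N #> x)"])
    show "subgroup (M \<inter> N) G" using nor normal_imp_subgroup by blast
    have "(\<lambda>x. (M #> x, N #> x)) ` carrier G \<subseteq> (rcosets M) \<times> (rcosets N)"
      using rcosetsI sM sN subgroup.subset by blast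
    then show "finite ((\<lambda>x. (M #> x, N #> x)) ` carrier G)"
      using M' N' finite_subset[OF _ finite_cartesian_product] by blast
  qed (use rcoset_eq_iff sM sN in auto)
  moreover have "\<exists>k. g [^] (p ^ k) \<in> M \<inter> N" if g: "g \<in> carrier G" for g
  proof -
    obtain k l where k: "g [^] (p ^ k) \<in> M" and l: "g [^] (p ^ l) \<in> N" using M' N' g by blast
    have "g [^] (p ^ (k + l)) \<in> M"
      using subgroup_nat_pow_closed[OF sM k, of "p ^ l"] by (simp add: nat_pow_pow g power_add)
    moreover have "g [^] (p ^ (k + l)) \<in> N"
      using subgroup_nat_pow_closed[OF sN l, of "p ^ k"]
      by (simp add: nat_pow_pow g power_add mult.commute)
    ultimately show ?thesis by blast
  qed
  ultimately show ?thesis using nor normal_p_index_iff[OF p] by blast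
qed


text \<open>Finitely many conditions, each inherited by smaller subgroups, can be met simultaneously.\<close>

lemma normal_p_index_common:
  fixes p r :: nat
  assumes p: "prime p" and ex: "\<And>k. k < r \<Longrightarrow> \<exists>N. normal_p_index p G N \<and> Q k N"
    and anti: "\<And>k M N. Q k N \<Longrightarrow> M \<subseteq> N \<Longrightarrow> Q k M"
  shows "\<exists>N. normal_p_index p G N \<and> (\<forall>k<r. Q k N)"
  using ex
proof (induction r)
  case 0
  then show ?case using normal_p_index_carrier by blast
next
  case (Suc r)
  then obtain N where N: "normal_p_index p G N" "\<forall>k<r. Q k N" by auto
  obtain M where M: "normal_p_index p G M" "Q r M" using Suc.prems by blast
  have "\<forall>k<Suc r. Q k (N \<inter> M)"
    using N(2) M(2) anti by (metis inf_le1 inf_le2 less_Suc_eq)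
  then show ?case using normal_p_index_Int[OF p N(1) M(1)] by blast
qed

text \<open>The order of \<open>c\<close> modulo \<open>N\<close> is a power of \<open>p\<close>, and it exceeds \<open>p ^ s\<close>.\<close>

lemma dvd_exponent_if_pow_mem:
  fixes p :: nat and i :: int
  assumes p: "prime p" and N: "normal_p_index p G N" and c: "c \<in> carrier G"
    and big: "c [^] (p ^ s) \<notin> N" and i: "c [^] i \<in> N"
  shows "int (p ^ Suc s) dvd i"
proof -
  have sN: "subgroup N G" using N normal_p_index_normal normal_imp_subgroup by blast
  obtain k where k: "c [^] (p ^ k) \<in> N" using N c normal_p_index_iff[OF p] by blast
  define d where "d = gcd i (int (p ^ k))"
  \<comment> \<open>Some power of \<open>p\<close> kills \<open>c\<close> modulo \<open>N\<close>, so \<open>i\<close> may be replaced by its gcd with that power.\<close>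
  obtain u v where uv: "u * i + v * int (p ^ k) = d"
    unfolding d_def using bezout_int by blast
  have "c [^] d = (c [^] i) [^] u \<otimes> (c [^] int (p ^ k)) [^] v"
    using c by (simp add: int_pow_pow int_pow_mult flip: uv) (simp add: mult.commute)
  then have dN: "c [^] d \<in> N"
    using subgroup_int_pow_closed[OF sN] i k subgroup.m_closed[OF sN] by (metis int_pow_int)
  have "nat d dvd p ^ k" unfolding d_def
    by (metis gcd_dvd2 gcd_ge_0_int int_dvd_int_iff int_nat_eq)
  then obtain t where t: "nat d = p ^ t"
    using divides_primepow_nat[OF p] by blast
  then have d: "d = int (p ^ t)" unfolding d_def by (metis gcd_ge_0_int nat_0_le)
  have "s < t"
  proof (rule ccontr)
    assume "\<not> s < t"
    then have "p ^ s = p ^ t * p ^ (s - t)" by (simp add: power_add[symmetric])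
    then have "c [^] (p ^ s) = (c [^] (p ^ t)) [^] (p ^ (s - t))" using c by (simp add: nat_pow_pow)
    then show False using big dN d subgroup_nat_pow_closed[OF sN] by (metis int_pow_int)
  qed
  then have "p ^ Suc s dvd p ^ t" by (intro le_imp_power_dvd) simp
  then have "int (p ^ Suc s) dvd d" unfolding d by (simp only: int_dvd_int_iff)
  moreover have "d dvd i" unfolding d_def by simp
  ultimately show ?thesis by (rule dvd_trans)
qed

end

text \<open>Quotients of \<open>G\<close> and homomorphisms onto finite \<open>p\<close>-groups separate the same elements; the
  carrier of the quotient is renamed to an initial segment of the natural numbers.\<close>

lemma (in group) p_separableI:
  fixes p :: nat
  assumes F: "subgroup F G"
    and sep: "\<And>g. g \<in> carrier G \<Longrightarrow> g \<notin> F \<Longrightarrow> \<exists>N. normal_p_index p G N \<and> g \<notin> F <#> N"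
  shows "p_separable p G F"
  unfolding p_separable_def
proof (intro conjI ballI F)
  fix g assume "g \<in> carrier G - F"
  then obtain N where g: "g \<in> carrier G" and N: "N \<lhd> G" "finite_p_index p G N" and gN: "g \<notin> F <#> N"
    using sep unfolding normal_p_index_def by blast
  interpret N: normal N G by fact
  interpret Q: group "G Mod N" by (rule N.factorgroup_is_group)
  obtain n where fin: "finite (rcosets N)" and card: "card (rcosets N) = p ^ n"
    using N(2) unfolding finite_p_index_def by blast
  obtain h where h: "bij_betw h (rcosets N) {0..<card (rcosets N)}"
    using ex_bij_betw_finite_nat[OF fin] by blast
  define u where "u = inv_into (rcosets N) h"
  define P :: "nat monoid" where
    "P = \<lparr>carrier = {0..<card (rcosets N)}, monoid.mult = \<lambda>i j. h (u i <#> u j), one = h N\<rparr>"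
  have car: "carrier (G Mod N) = rcosets N" by (simp add: FactGroup_def)
  have uh: "u (h x) = x" if "x \<in> rcosets N" for x
    unfolding u_def using h that by (auto simp: bij_betw_def)
  have iso: "h \<in> iso (G Mod N) P"
  proof (rule isoI)
    show "h \<in> hom (G Mod N) P"
    proof (rule homI)
      fix x y assume x: "x \<in> carrier (G Mod N)" and y: "y \<in> carrier (G Mod N)"
      show "h x \<in> carrier P" using x h unfolding car P_def bij_betw_def by auto
      show "h (x \<otimes>\<^bsub>G Mod N\<^esub> y) = h x \<otimes>\<^bsub>P\<^esub> h y"
        using x y unfolding car P_def by (simp add: uh)
    qed
    show "bij_betw h (carrier (G Mod N)) (carrier P)" using h unfolding car P_def by simp
  qed
  have oneN: "\<one>\<^bsub>G Mod N\<^esub> = N" by (simp add: FactGroup_def)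
  have "group (P\<lparr>one := h \<one>\<^bsub>G Mod N\<^esub>\<rparr>)"
    by (rule Q.iso_imp_img_group[OF iso])
  moreover have "P\<lparr>one := h \<one>\<^bsub>G Mod N\<^esub>\<rparr> = P" by (simp add: P_def oneN)
  ultimately have P: "group P" by simp
  have "finite_p_group p P" unfolding finite_p_group_def using P card
    by (simp add: P_def order_def) blast
  moreover have "(\<lambda>x. h (N #> x)) \<in> epi G P"
  proof -
    have "(\<lambda>x. h (N #> x)) \<in> hom G P"
      using N.r_coset_hom_Mod iso unfolding hom_def iso_def by (auto simp: Pi_def)
    moreover have "(\<lambda>x. h (N #> x)) ` carrier G = carrier P"
    proof -
      have "(\<lambda>x. N #> x) ` carrier G = rcosets N" unfolding RCOSETS_def by blast
      then have "h ` (\<lambda>x. N #> x) ` carrier G = carrier P"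
        using h unfolding bij_betw_def P_def by simp
      then show ?thesis by (simp add: image_image)
    qed
    ultimately show ?thesis by (simp add: epi_def)
  qed
  moreover have "h (N #> g) \<notin> (\<lambda>x. h (N #> x)) ` F"
  proof
    assume "h (N #> g) \<in> (\<lambda>x. h (N #> x)) ` F"
    then obtain f where f: "f \<in> F" "h (N #> g) = h (N #> f)" by blast
    have fG: "f \<in> carrier G" using f F subgroup.mem_carrier by metis
    have "N #> g = N #> f"
      using f(2) uh g fG rcosetsI[OF N.subset] by metis
    then have "g \<in> N #> f" using rcos_self[OF g N.subgroup_axioms] by simp
    then have "g \<in> f <# N" using N.coset_eq fG by blast
    then show False using gN f(1) unfolding l_coset_def set_mult_def by blast
  qed
  ultimately show "\<exists>(P :: nat monoid) \<psi>. finite_p_group p P \<and> \<psi> \<in> epi G P \<and> \<psi> g \<notin> \<psi> ` F" by blast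
qed

section \<open>Reduced words over two subgroups\<close>

text \<open>The factors are indexed by \<open>bool\<close> so that statements about the two of them are proved once.
  The assumption \<open>factors_induct\<close> says that the factors generate the group.\<close>

locale two_factors = group G for G (structure) +
  fixes H :: "'a set" and X :: "bool \<Rightarrow> 'a set"
  assumes subH: "subgroup H G" and subX: "subgroup (X b) G" and HX: "H \<subseteq> X b"
    and factors_induct:
      "\<lbrakk>g \<in> carrier G; Q \<one>; \<And>g b y. g \<in> carrier G \<Longrightarrow> Q g \<Longrightarrow> y \<in> X b \<Longrightarrow> Q (g \<otimes> y)\<rbrakk> \<Longrightarrow> Q g"
begin

text \<open>Words are functions with a separate length: taking prefixes and repeating a word periodically then
  need no list operations, and the partial products \<open>word_prod w k\<close> are the objects of interest. The
  letter in position \<open>k\<close> comes from \<open>X b\<close> for even \<open>k\<close> and from the other factor for odd \<open>k\<close>.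
  The letters are only required to avoid a set \<open>E\<close>, so that being reduced makes sense modulo a
  normal subgroup \<open>N\<close>, with \<open>E = H N\<close>.\<close>

primrec word_prod :: "(nat \<Rightarrow> 'a) \<Rightarrow> nat \<Rightarrow> 'a" where
  "word_prod w 0 = \<one>"
| "word_prod w (Suc k) = word_prod w k \<otimes> w k"

definition reduced :: "'a set \<Rightarrow> bool \<Rightarrow> (nat \<Rightarrow> 'a) \<Rightarrow> nat \<Rightarrow> bool" where
  "reduced E b w r \<longleftrightarrow> (\<forall>k<r. w k \<in> X (even k = b) - E)"

lemma X_carrier: "y \<in> X b \<Longrightarrow> y \<in> carrier G"
  using subX subgroup.mem_carrier by metis

lemma H_carrier: "h \<in> H \<Longrightarrow> h \<in> carrier G"
  using subH subgroup.mem_carrier by metis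

lemma H_X: "h \<in> H \<Longrightarrow> h \<in> X b"
  using HX by blast

lemma X_mult: "x \<in> X b \<Longrightarrow> y \<in> X b \<Longrightarrow> x \<otimes> y \<in> X b"
  by (rule subgroup.m_closed[OF subX])

lemma H_mult: "x \<in> H \<Longrightarrow> y \<in> H \<Longrightarrow> x \<otimes> y \<in> H"
  by (rule subgroup.m_closed[OF subH])

lemma H_inv: "x \<in> H \<Longrightarrow> inv x \<in> H"
  by (rule subgroup.m_inv_closed[OF subH])

lemma reducedD: "reduced E b w r \<Longrightarrow> k < r \<Longrightarrow> w k \<in> X (even k = b)"
  "reduced E b w r \<Longrightarrow> k < r \<Longrightarrow> w k \<notin> E"
  by (auto simp: reduced_def)

lemma reduced_carrier: "reduced E b w r \<Longrightarrow> k < r \<Longrightarrow> w k \<in> carrier G"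
  using reducedD X_carrier by metis

lemma reduced_mono: "reduced E b w r \<Longrightarrow> k \<le> r \<Longrightarrow> reduced E b w k"
  by (simp add: reduced_def)

lemma word_prod_carrier: "(\<And>k. k < r \<Longrightarrow> w k \<in> carrier G) \<Longrightarrow> word_prod w r \<in> carrier G"
  by (induction r) auto

lemma reduced_word_prod_carrier: "reduced E b w r \<Longrightarrow> k \<le> r \<Longrightarrow> word_prod w k \<in> carrier G"
  using word_prod_carrier reduced_carrier by (metis order_less_le_trans)

lemma word_prod_cong: "(\<And>k. k < r \<Longrightarrow> w k = v k) \<Longrightarrow> word_prod w r = word_prod v r"
  by (induction r) auto

lemma word_prod_update: "r \<le> k \<Longrightarrow> word_prod (w(k := y)) r = word_prod w r"
  by (rule word_prod_cong) auto

lemma word_prod_shift: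
  "(\<And>k. k \<le> r \<Longrightarrow> w k \<in> carrier G) \<Longrightarrow> word_prod w (Suc r) = w 0 \<otimes> word_prod (\<lambda>k. w (Suc k)) r"
proof (induction r)
  case (Suc r)
  have "word_prod (\<lambda>k. w (Suc k)) r \<in> carrier G"
    using Suc.prems by (intro word_prod_carrier) simp
  then show ?case using Suc by (simp add: m_assoc)
qed simp

lemma reduced_mult_H:
  assumes w: "reduced H b w r" and "0 < r" and h: "h \<in> H"
  shows "\<exists>v. reduced H b v r \<and> word_prod v r = word_prod w r \<otimes> h"
proof -
  obtain s where r: "r = Suc s" using \<open>0 < r\<close> gr0_conv_Suc by blast
  let ?v = "w(s := w s \<otimes> h)"
  have ws: "w s \<in> X (even s = b)" "w s \<notin> H" "w s \<in> carrier G"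
    using w r by (auto dest: reducedD reduced_carrier)
  have "w s \<otimes> h \<in> X (even s = b)" using X_mult[OF ws(1) H_X[OF h]] .
  moreover have "w s \<otimes> h \<notin> H"
  proof
    assume "w s \<otimes> h \<in> H"
    then have "(w s \<otimes> h) \<otimes> inv h \<in> H" using h H_mult H_inv by blast
    then show False using ws h H_carrier by (simp add: m_assoc)
  qed
  ultimately have "reduced H b ?v r" using w r by (auto simp: reduced_def)
  moreover have "word_prod ?v r = word_prod w r \<otimes> h"
    using ws h H_carrier reduced_word_prod_carrier[OF w, of s] r
    by (simp add: word_prod_update m_assoc)
  ultimately show ?thesis by blast
qed

text \<open>A new letter is appended, absorbed into the last letter, or, if that makes the last letter fall
  into \<open>H\<close>, both are absorbed into the letter before it.\<close>

lemma reduced_mult_factor: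
  assumes w: "reduced H b w r" and y: "y \<in> X c"
  shows "word_prod w r \<otimes> y \<in> H \<or> (\<exists>b v s. 0 < s \<and> reduced H b v s \<and> word_prod w r \<otimes> y = word_prod v s)"
proof (cases "y \<in> H")
  case yH: True
  show ?thesis
  proof (cases "r = 0")
    case True
    then show ?thesis using yH H_carrier by simp
  next
    case False
    then show ?thesis using reduced_mult_H[OF w _ yH] by (metis gr0I)
  qed
next
  case yH: False
  have yG: "y \<in> carrier G" using y by (rule X_carrier)
  show ?thesis
  proof (cases r)
    case 0
    have "reduced H c (\<lambda>_. y) 1" using y yH by (simp add: reduced_def)
    moreover have "word_prod w r \<otimes> y = word_prod (\<lambda>_. y) 1" using 0 by simp
    ultimately show ?thesis by (metis zero_less_one)
  next
    case (Suc s)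
    show ?thesis
    proof (cases "c = (even r = b)")
      case True
      have "reduced H b (w(r := y)) (Suc r)"
        using w y yH True by (auto simp: reduced_def less_Suc_eq)
      moreover have "word_prod (w(r := y)) (Suc r) = word_prod w r \<otimes> y"
        by (simp add: word_prod_update)
      ultimately show ?thesis by (metis zero_less_Suc)
    next
      case False
      then have c: "c = (even s = b)" using Suc by auto
      have ws: "w s \<in> X c" "w s \<in> carrier G"
        using w Suc c by (auto dest: reducedD reduced_carrier)
      define z where "z = w s \<otimes> y"
      have zX: "z \<in> X c" unfolding z_def using X_mult ws y by simp
      have P: "word_prod w s \<in> carrier G" using reduced_word_prod_carrier[OF w] Suc by simp
      have eq: "word_prod w r \<otimes> y = word_prod w s \<otimes> z"
        unfolding z_def Suc using P ws yG by (simp add: m_assoc)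
      have ws': "reduced H b w s" using reduced_mono[OF w] Suc by simp
      show ?thesis
      proof (cases "z \<in> H")
        case True
        show ?thesis
        proof (cases "s = 0")
          case True
          then show ?thesis using eq \<open>z \<in> H\<close> H_carrier by simp
        next
          case False
          then show ?thesis using reduced_mult_H[OF ws' _ \<open>z \<in> H\<close>] eq by (metis gr0I)
        qed
      next
        case zH: False
        have "reduced H b (w(s := z)) r"
          using w zX zH c Suc by (auto simp: reduced_def less_Suc_eq)
        moreover have "word_prod (w(s := z)) r = word_prod w s \<otimes> z"
          by (simp add: word_prod_update Suc)
        ultimately show ?thesis using eq Suc by (metis zero_less_Suc)
      qed
    qed
  qed
qed

lemma reduced_form:
  assumes "g \<in> carrier G"
  shows "g \<in> H \<or> (\<exists>b w r. 0 < r \<and> reduced H b w r \<and> g = word_prod w r)"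
  using assms
proof (rule factors_induct)
  show "\<one> \<in> H \<or> (\<exists>b w r. 0 < r \<and> reduced H b w r \<and> \<one> = word_prod w r)"
    using subgroup.one_closed[OF subH] by simp
  fix g b y
  assume g: "g \<in> carrier G" and y: "y \<in> X b"
    and IH: "g \<in> H \<or> (\<exists>b w r. 0 < r \<and> reduced H b w r \<and> g = word_prod w r)"
  from IH show "g \<otimes> y \<in> H \<or> (\<exists>b w r. 0 < r \<and> reduced H b w r \<and> g \<otimes> y = word_prod w r)"
  proof
    assume "g \<in> H"
    then have "g \<otimes> y \<in> X b" using X_mult H_X y by blast
    then show ?thesis
      using reduced_mult_factor[of b "\<lambda>_. \<one>" 0 "g \<otimes> y" b] g y X_carrier by (simp add: reduced_def)
  next
    assume "\<exists>b w r. 0 < r \<and> reduced H b w r \<and> g = word_prod w r"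
    then show ?thesis using reduced_mult_factor y by blast
  qed
qed

text \<open>An odd reduced word begins and ends in the same factor; conjugating by its last letter
  merges the two letters and shortens the word, until it is a single letter or has even length.\<close>

lemma conjugate_cyclically_reduced:
  assumes g: "g \<in> carrier G"
  obtains t b where "t \<in> carrier G" "t \<otimes> g \<otimes> inv t \<in> X b"
  | t b w r where "t \<in> carrier G" "0 < r" "even r" "reduced H b w r" "t \<otimes> g \<otimes> inv t = word_prod w r"
proof -
  let ?C = "\<lambda>g. (\<exists>t\<in>carrier G. \<exists>b. t \<otimes> g \<otimes> inv t \<in> X b) \<or>
    (\<exists>t\<in>carrier G. \<exists>b w r. 0 < r \<and> even r \<and> reduced H b w r \<and> t \<otimes> g \<otimes> inv t = word_prod w r)"
  have conj: "?C g" if "?C (z \<otimes> g \<otimes> inv z)" and z: "z \<in> carrier G" and g: "g \<in> carrier G" for z g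
  proof -
    have "t \<otimes> (z \<otimes> g \<otimes> inv z) \<otimes> inv t = (t \<otimes> z) \<otimes> g \<otimes> inv (t \<otimes> z)" if "t \<in> carrier G" for t
      using that z g by (simp add: m_assoc inv_mult_group)
    then show ?thesis using that(1) z by (metis m_closed)
  qed
  have triv: "?C g" if "g \<in> X b" for g b
    using that X_carrier by (intro disjI1 bexI[of _ \<one>] exI[of _ b]) auto
  have word: "?C (word_prod w r)" if "reduced H b w r" "0 < r" for b w r
    using that
  proof (induction r arbitrary: b w rule: less_induct)
    case (less r)
    note w = less.prems(1)
    have cl: "\<And>k. k < r \<Longrightarrow> w k \<in> carrier G" using w reduced_carrier by blast
    have PG: "word_prod w r \<in> carrier G" using word_prod_carrier cl by blast
    consider "even r" | "r = 1" | s where "r = Suc (Suc (Suc s))" "even s"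
    proof (cases "even r \<or> r = 1")
      case False
      then obtain s where s: "r = Suc s" "even s" "s \<noteq> 0" by (cases r) auto
      then obtain s' where "s = Suc s'" by (cases s) auto
      with s obtain s'' where "s = Suc (Suc s'')" by (cases s') auto
      with s that(3) show ?thesis by simp
    qed (use that in blast)
    then show ?case
    proof cases
      case 1
      then show ?thesis using less.prems PG by (intro disjI2 bexI[of _ \<one>]) auto
    next
      case 2
      then have "word_prod w r \<in> X b" using reducedD(1)[OF w, of 0] cl by simp
      then show ?thesis by (rule triv)
    next
      case 3
      define z where "z = w (Suc (Suc s))"
      define y where "y = z \<otimes> w 0"
      have zG: "z \<in> carrier G" unfolding z_def using cl 3 by simp
      have zX: "z \<in> X b" "w 0 \<in> X b"
        using reducedD(1)[OF w, of "Suc (Suc s)"] reducedD(1)[OF w, of 0] 3 by (auto simp: z_def)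
      then have yX: "y \<in> X b" unfolding y_def using X_mult by blast
      have yG: "y \<in> carrier G" using yX X_carrier by blast
      define R where "R = word_prod (\<lambda>k. w (Suc k)) (Suc s)"
      have RG: "R \<in> carrier G" unfolding R_def using cl 3 by (intro word_prod_carrier) simp
      have "word_prod w r = w 0 \<otimes> R \<otimes> z"
        unfolding R_def z_def using 3 cl by (subst 3(1), subst word_prod.simps(2), subst word_prod_shift) auto
      \<comment> \<open>\<open>y\<close> is the merged letter, and \<open>R\<close> the product of the letters strictly between the first and
        the last.\<close>
      then have cj: "z \<otimes> word_prod w r \<otimes> inv z = y \<otimes> R"
        unfolding y_def using zG RG cl 3 by (simp add: m_assoc)
      have "?C (y \<otimes> R)"
      proof (cases "y \<in> H")
        case False
        let ?v = "w(0 := y)"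
        have "reduced H b ?v (Suc (Suc s))" using w yX False 3 by (auto simp: reduced_def)
        moreover have "word_prod ?v (Suc (Suc s)) = y \<otimes> R"
          unfolding R_def using cl 3 yG by (subst word_prod_shift) auto
        ultimately show ?thesis using 3 yG RG
          by (intro disjI2 bexI[of _ \<one>] exI[of _ b] exI[of _ ?v] exI[of _ "Suc (Suc s)"]) auto
      next
        case True
        \<comment> \<open>Here the merged letter disappears into its neighbour, and the word gets shorter by two.\<close>
        let ?v = "(\<lambda>k. w (Suc k))(0 := y \<otimes> w 1)"
        have w1: "w 1 \<in> X (\<not> b)" "w 1 \<notin> H" "w 1 \<in> carrier G"
          using reducedD[OF w, of 1] cl 3 by auto
        have "y \<otimes> w 1 \<in> X (\<not> b)" using X_mult[OF H_X[OF True] w1(1)] .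
        moreover have "y \<otimes> w 1 \<notin> H"
        proof
          assume "y \<otimes> w 1 \<in> H"
          then have "inv y \<otimes> (y \<otimes> w 1) \<in> H" using True H_mult H_inv by blast
          then show False using w1 yG by (simp add: m_assoc[symmetric])
        qed
        moreover have "w (Suc k) \<in> X (even k = (\<not> b)) - H" if "k < Suc s" for k
          using reducedD[OF w, of "Suc k"] that 3 by (cases b) auto
        ultimately have v: "reduced H (\<not> b) ?v (Suc s)"
          unfolding reduced_def by auto
        have "word_prod ?v (Suc s) = y \<otimes> R"
          unfolding R_def using cl 3 yG w1 by (subst (1 2) word_prod_shift) (auto simp: m_assoc word_prod_carrier)
        moreover have "?C (word_prod ?v (Suc s))" by (rule less.IH[OF _ v]) (use 3 in auto)
        ultimately show ?thesis by (simp only:)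
      qed
      then show ?thesis using conj[OF _ zG PG] cj by simp
    qed
  qed
  have "?C g" using reduced_form[OF g]
  proof
    assume "g \<in> H"
    then show "?C g" using H_X triv by blast
  next
    assume "\<exists>b w r. 0 < r \<and> reduced H b w r \<and> g = word_prod w r"
    then show "?C g" using word by blast
  qed
  then show thesis using that by blast
qed

end

section \<open>Edge cocycles\<close>

context two_factors
begin

text \<open>In the Bass--Serre tree the path from the vertex fixed by \<open>X b\<close> to its translate by
  \<open>y \<in> X (\<not> b)\<close> consists of the base edge and its translate by \<open>y\<close>, in opposite directions. With
  \<open>E = H\<close>, the number \<open>\<delta> g x\<close> is the signed count of the edge of the coset \<open>x H\<close> on the path from the
  vertex of \<open>X b\<close> to its translate by \<open>g\<close>; for a larger \<open>E\<close> the edges are counted modulo \<open>E\<close>.\<close>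

definition edge_cocycle :: "'a set \<Rightarrow> bool \<Rightarrow> ('a \<Rightarrow> 'a \<Rightarrow> int) \<Rightarrow> bool" where
  "edge_cocycle E b \<delta> \<longleftrightarrow>
    (\<forall>g\<in>carrier G. \<forall>h\<in>carrier G. \<forall>x\<in>carrier G. \<delta> (g \<otimes> h) x = \<delta> g x + \<delta> h (inv g \<otimes> x)) \<and>
    (\<forall>c. \<forall>y\<in>X c. \<forall>x\<in>carrier G.
      \<delta> y x = of_bool (c \<noteq> b) * (of_bool (x \<in> E) - of_bool (inv y \<otimes> x \<in> E)))"

lemma edge_cocycle_mult:
  "\<lbrakk>edge_cocycle E b \<delta>; g \<in> carrier G; h \<in> carrier G; x \<in> carrier G\<rbrakk>
    \<Longrightarrow> \<delta> (g \<otimes> h) x = \<delta> g x + \<delta> h (inv g \<otimes> x)"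
  by (simp add: edge_cocycle_def)

lemma edge_cocycle_factor:
  "\<lbrakk>edge_cocycle E b \<delta>; y \<in> X c; x \<in> carrier G\<rbrakk>
    \<Longrightarrow> \<delta> y x = of_bool (c \<noteq> b) * (of_bool (x \<in> E) - of_bool (inv y \<otimes> x \<in> E))"
  by (simp add: edge_cocycle_def)

lemma edge_cocycle_one: "edge_cocycle E b \<delta> \<Longrightarrow> x \<in> carrier G \<Longrightarrow> \<delta> \<one> x = 0"
  using edge_cocycle_factor[of E b \<delta> \<one> b x] subgroup.one_closed[OF subX] by simp

text \<open>The letters from \<open>X b\<close> fix the base vertex, so only every second letter of a reduced word
  contributes to the path.\<close>

definition letter_weight :: "bool \<Rightarrow> bool \<Rightarrow> nat \<Rightarrow> int" where
  "letter_weight b c k = of_bool ((even k = c) \<noteq> b)"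

lemma letter_weight_Suc: "letter_weight b c (Suc k) = 1 - letter_weight b c k"
  unfolding letter_weight_def by (cases b; cases c) auto

lemma edge_cocycle_word_prod:
  assumes \<delta>: "edge_cocycle E b \<delta>" and w: "reduced F c w r" and y: "y \<in> carrier G"
  shows "\<delta> (word_prod w r) y = (\<Sum>k<r. letter_weight b c k *
    (of_bool (inv (word_prod w k) \<otimes> y \<in> E) - of_bool (inv (word_prod w (Suc k)) \<otimes> y \<in> E)))"
  using w
proof (induction r)
  case 0
  then show ?case using edge_cocycle_one[OF \<delta> y] by simp
next
  case (Suc r)
  have P: "word_prod w r \<in> carrier G" and wr: "w r \<in> carrier G" "w r \<in> X (even r = c)"
    using reduced_word_prod_carrier[OF Suc.prems, of r] reduced_carrier[OF Suc.prems, of r]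
      reducedD[OF Suc.prems, of r] by auto
  have "inv (w r) \<otimes> (inv (word_prod w r) \<otimes> y) = inv (word_prod w (Suc r)) \<otimes> y"
    using P wr y by (simp add: inv_mult_group m_assoc)
  then have "\<delta> (w r) (inv (word_prod w r) \<otimes> y) = letter_weight b c r *
      (of_bool (inv (word_prod w r) \<otimes> y \<in> E) - of_bool (inv (word_prod w (Suc r)) \<otimes> y \<in> E))"
    using edge_cocycle_factor[OF \<delta> wr(2), of "inv (word_prod w r) \<otimes> y"] P y
    unfolding letter_weight_def by simp
  then show ?case
    using Suc.IH reduced_mono[OF Suc.prems, of r] edge_cocycle_mult[OF \<delta> P wr(1) y] by simp
qed

text \<open>Evaluates the path of a word at an edge that it meets exactly once, in position \<open>m\<close>: the two
  neighbouring summands contribute the weights on the two sides of that position.\<close>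

lemma sum_single_position:
  fixes \<sigma> :: "nat \<Rightarrow> int"
  assumes "s \<le> m" "m \<le> t" and e: "\<And>k. s \<le> k \<Longrightarrow> k \<le> t \<Longrightarrow> e k \<longleftrightarrow> k = m"
  shows "(\<Sum>k=s..<t. \<sigma> k * (of_bool (e k) - of_bool (e (Suc k)))) =
    (if m < t then \<sigma> m else 0) - (if s < m then \<sigma> (m - 1) else 0)"
proof -
  have "(\<Sum>k=s..<t. \<sigma> k * (of_bool (e k) - of_bool (e (Suc k)))) =
      (\<Sum>k=s..<t. (if k = m then \<sigma> k else 0) - (if k = m - 1 \<and> s < m then \<sigma> k else 0))"
    by (rule sum.cong) (use e assms in auto)
  also have "\<dots> = (\<Sum>k=s..<t. if k = m then \<sigma> k else 0) -
      (\<Sum>k=s..<t. if k = m - 1 \<and> s < m then \<sigma> k else 0)"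
    by (rule sum_subtractf)
  also have "(\<Sum>k=s..<t. if k = m then \<sigma> k else 0) = (if m < t then \<sigma> m else 0)"
    using assms by (simp add: sum.delta)
  also have "(\<Sum>k=s..<t. if k = m - 1 \<and> s < m then \<sigma> k else 0) = (if s < m then \<sigma> (m - 1) else 0)"
    using assms by (cases "s < m") (auto simp: sum.delta)
  finally show ?thesis .
qed

lemma mult_normal_subgroup:
  assumes "N \<lhd> G"
  shows "subgroup (H <#> N) G" "H \<subseteq> H <#> N" "N \<subseteq> H <#> N"
proof -
  show "subgroup (H <#> N) G"
    using mult_norm_subgroup[OF assms subH] commut_normal[OF subH assms] by simp
  show "H \<subseteq> H <#> N" "N \<subseteq> H <#> N"
    using subgroup.one_closed[OF subH] subgroup.one_closed[OF normal_imp_subgroup[OF assms]]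
      H_carrier subgroup.mem_carrier[OF normal_imp_subgroup[OF assms]]
    unfolding set_mult_def by force+
qed

end

text \<open>The cocycles stand for the universal property of the amalgamated free product: they are the maps
  out of it from which all finite quotients below are built.\<close>

locale amalgam = two_factors +
  fixes p :: nat
  assumes p: "prime p"
    and edge_cocycle_exists: "subgroup E G \<Longrightarrow> H \<subseteq> E \<Longrightarrow> \<exists>\<delta>. edge_cocycle E b \<delta>"
begin

text \<open>The subgroups \<open>N\<close> that leave the finite images of the factors in \<open>G / M\<close> unchanged: \<open>G / N\<close> is then
  a quotient of the amalgamated product of these images.\<close>

definition refines :: "'a set \<Rightarrow> 'a set \<Rightarrow> bool" where
  "refines M N \<longleftrightarrow> normal_p_index p G N \<and> N \<subseteq> M \<and> (\<forall>b. X b \<inter> M \<subseteq> N)"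

text \<open>The kernel of \<open>\<delta>\<close> modulo \<open>p\<close> on \<open>N\<close> is the required \<open>N'\<close>. All values of \<open>\<delta>\<close> are functions on
  \<open>G / H N\<close>, on which \<open>N\<close> acts trivially; so \<open>\<delta>\<close> is additive on \<open>N\<close>, and there are only finitely many
  values modulo \<open>p\<close>. It vanishes on the elements of the factors that lie in \<open>N\<close>, since these fix
  the coset \<open>H N\<close>.\<close>

lemma refine_by_cocycle:
  assumes MN: "refines M N"
  obtains \<delta> N' where "edge_cocycle (H <#> N) b \<delta>" "refines M N'" "N' \<subseteq> N"
    "\<And>g x. g \<in> X b <#> N' \<Longrightarrow> x \<in> carrier G \<Longrightarrow> int p dvd \<delta> g x"
proof -
  have npi: "normal_p_index p G N" using MN by (simp add: refines_def)
  have nor: "N \<lhd> G" by (rule normal_p_index_normal[OF npi])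
  interpret N: normal N G by (rule nor)
  let ?E = "H <#> N"
  note E = mult_normal_subgroup[OF nor]
  obtain \<delta> where \<delta>: "edge_cocycle ?E b \<delta>" using edge_cocycle_exists[OF E(1,2)] by blast
  note mult = edge_cocycle_mult[OF \<delta>] and one = edge_cocycle_one[OF \<delta>]
  have NE: "n \<otimes> x \<in> ?E \<longleftrightarrow> x \<in> ?E" if "n \<in> N" "x \<in> carrier G" for n x
  proof
    assume "n \<otimes> x \<in> ?E"
    then have "inv n \<otimes> (n \<otimes> x) \<in> ?E" using that E
      by (meson subgroup.m_closed subgroup.m_inv_closed subsetD)
    then show "x \<in> ?E" using that by (simp add: m_assoc[symmetric])
  qed (use that E in \<open>auto intro: subgroup.m_closed\<close>)
  have shift: "\<exists>m\<in>N. inv g \<otimes> (n \<otimes> x) = m \<otimes> (inv g \<otimes> x)"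
    if "g \<in> carrier G" "n \<in> N" "x \<in> carrier G" for g n x
  proof (intro bexI[of _ "inv g \<otimes> n \<otimes> g"])
    have "g \<otimes> (inv g \<otimes> x) = x" using that by (simp add: m_assoc[symmetric])
    then show "inv g \<otimes> (n \<otimes> x) = inv g \<otimes> n \<otimes> g \<otimes> (inv g \<otimes> x)" using that by (simp add: m_assoc)
    show "inv g \<otimes> n \<otimes> g \<in> N" using N.inv_op_closed1[OF that(1,2)] .
  qed
  have inv_factor: "\<delta> y (n \<otimes> x) = \<delta> y x" if "y \<in> X c" "n \<in> N" "x \<in> carrier G" for y c n x
  proof -
    note n = that(2) and x = that(3)
    have yG: "y \<in> carrier G" using that(1) by (rule X_carrier)
    obtain m where m: "m \<in> N" "inv y \<otimes> (n \<otimes> x) = m \<otimes> (inv y \<otimes> x)"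
      using shift[OF yG n x] by blast
    have "n \<otimes> x \<in> carrier G" using that by simp
    then show ?thesis
      using edge_cocycle_factor[OF \<delta> that(1)] x NE[OF n x] NE[OF m(1), of "inv y \<otimes> x"] m(2) yG
      by simp
  qed
  have inv: "\<forall>n\<in>N. \<forall>x\<in>carrier G. \<delta> g (n \<otimes> x) = \<delta> g x" if "g \<in> carrier G" for g
    using that
  proof (rule factors_induct)
    show "\<forall>n\<in>N. \<forall>x\<in>carrier G. \<delta> \<one> (n \<otimes> x) = \<delta> \<one> x" using one by simp
    fix g c y assume g: "g \<in> carrier G" and y: "y \<in> X c"
      and IH: "\<forall>n\<in>N. \<forall>x\<in>carrier G. \<delta> g (n \<otimes> x) = \<delta> g x"
    show "\<forall>n\<in>N. \<forall>x\<in>carrier G. \<delta> (g \<otimes> y) (n \<otimes> x) = \<delta> (g \<otimes> y) x"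
    proof (intro ballI)
      fix n x assume n: "n \<in> N" and x: "x \<in> carrier G"
      obtain m where m: "m \<in> N" "inv g \<otimes> (n \<otimes> x) = m \<otimes> (inv g \<otimes> x)"
        using shift[OF g n x] by blast
      show "\<delta> (g \<otimes> y) (n \<otimes> x) = \<delta> (g \<otimes> y) x"
        using IH n x m g y X_carrier[OF y] by (simp add: mult inv_factor)
    qed
  qed
  have add: "\<delta> (n \<otimes> g) x = \<delta> n x + \<delta> g x" if "n \<in> N" "g \<in> carrier G" "x \<in> carrier G" for n g x
    using that inv mult by simp
  have cancel: "\<delta> (inv g) (inv g \<otimes> x) = - \<delta> g x" if "g \<in> carrier G" "x \<in> carrier G" for g x
    using mult[of g "inv g" x] one that by simp
  define N' where "N' = {n \<in> N. \<forall>x\<in>carrier G. int p dvd \<delta> n x}"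
  have sub: "subgroup N' G"
  proof (rule subgroupI)
    show "N' \<subseteq> carrier G" unfolding N'_def by auto
    have "\<one> \<in> N'" unfolding N'_def using one by simp
    then show "N' \<noteq> {}" by blast
    fix n assume n: "n \<in> N'"
    have "\<delta> (inv n) x = - \<delta> n x" if "x \<in> carrier G" for x
    proof -
      have "n \<in> N" "n \<in> carrier G" using n N'_def by auto
      then show ?thesis using cancel[of n x] inv[of "inv n"] that by simp
    qed
    then show "inv n \<in> N'" using n unfolding N'_def by simp
    fix m assume "m \<in> N'"
    then show "n \<otimes> m \<in> N'" using n add unfolding N'_def by simp
  qed
  have nor': "N' \<lhd> G"
  proof (subst normal_inv_iff, intro conjI sub ballI)
    fix g n assume g: "g \<in> carrier G" and n: "n \<in> N'"
    have nN: "n \<in> N" "n \<in> carrier G" using n unfolding N'_def by auto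
    have "\<delta> (g \<otimes> n \<otimes> inv g) x = \<delta> n (inv g \<otimes> x)" if "x \<in> carrier G" for x
    proof -
      have "\<delta> (g \<otimes> n \<otimes> inv g) x = \<delta> g x + \<delta> (n \<otimes> inv g) (inv g \<otimes> x)"
        using mult[of g "n \<otimes> inv g" x] g nN that by (simp add: m_assoc)
      then show ?thesis using add[OF nN(1), of "inv g" "inv g \<otimes> x"] cancel g that by simp
    qed
    then show "g \<otimes> n \<otimes> inv g \<in> N'"
      using n g N.inv_op_closed2 unfolding N'_def by simp
  qed
  have pow: "\<delta> (n [^] (j::nat)) x = int j * \<delta> n x" if "n \<in> N" "x \<in> carrier G" for n j x
  proof (induction j)
    case (Suc j)
    have "n [^] j \<in> N" using subgroup_nat_pow_closed[OF N.subgroup_axioms] that by blast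
    then show ?case using Suc that add by (simp add: algebra_simps)
  qed (use one that in simp)
  note npi' = npi[unfolded normal_p_index_iff[OF p]]
  have fin: "finite (rcosets N')"
  proof -
    \<comment> \<open>A value of \<open>\<delta>\<close> is determined by its restriction to a finite set of coset representatives.\<close>
    define T where "T = (\<lambda>K. SOME t. t \<in> K) ` (rcosets N)"
    have finT: "finite T" using npi' T_def by simp
    have T: "\<exists>t\<in>T. t \<in> carrier G \<and> (\<exists>n\<in>N. x = n \<otimes> t)" if x: "x \<in> carrier G" for x
    proof -
      let ?t = "SOME t. t \<in> N #> x"
      have "?t \<in> N #> x" using rcos_self[OF x N.subgroup_axioms] by (rule someI)
      then obtain n where n: "n \<in> N" "?t = n \<otimes> x" unfolding r_coset_def by blast
      then have "x = inv n \<otimes> ?t" using x by (simp add: m_assoc[symmetric])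
      moreover have "?t \<in> T" unfolding T_def using x rcosetsI[OF N.subset] by blast
      ultimately show ?thesis using n x by (metis N.mem_carrier N.m_inv_closed m_closed)
    qed
    define f where "f g = (N #> g, restrict (\<lambda>t. \<delta> g t mod int p) T)" for g
    show ?thesis
    proof (rule finite_rcosetsI[OF sub, of f])
      have "f ` carrier G \<subseteq> (rcosets N) \<times> (T \<rightarrow>\<^sub>E {0..<int p})"
        using rcosetsI[OF N.subset] prime_gt_0_nat[OF p] unfolding f_def by auto
      moreover have "finite (T \<rightarrow>\<^sub>E {0..<int p})" using finT by (simp add: finite_PiE)
      ultimately show "finite (f ` carrier G)"
        using npi' finite_subset[OF _ finite_cartesian_product] by blast
      fix x y assume x: "x \<in> carrier G" and y: "y \<in> carrier G" and eq: "f x = f y"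
      define m where "m = x \<otimes> inv y"
      have m: "m \<in> N" using eq rcoset_eq_iff[OF N.subgroup_axioms x y] unfolding f_def m_def by simp
      have xm: "x = m \<otimes> y" unfolding m_def using x y by (simp add: m_assoc)
      have "int p dvd \<delta> m z" if z: "z \<in> carrier G" for z
      proof -
        obtain t n where t: "t \<in> T" "t \<in> carrier G" "n \<in> N" "z = n \<otimes> t" using T[OF z] by blast
        have "\<delta> x t mod int p = \<delta> y t mod int p"
          using arg_cong[OF eq, of "\<lambda>v. snd v t"] t(1) unfolding f_def by simp
        then have "int p dvd \<delta> m t" unfolding xm add[OF m y t(2)]
          by (metis add_diff_cancel_right' mod_eq_dvd_iff)
        then show ?thesis using inv m t by simp
      qed
      then show "x \<otimes> inv y \<in> N'" using m unfolding N'_def m_def by blast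
    qed
  qed
  have "\<exists>k. g [^] (p ^ k) \<in> N'" if g: "g \<in> carrier G" for g
  proof -
    obtain k where k: "g [^] (p ^ k) \<in> N" using npi' g by blast
    then have "(g [^] (p ^ k)) [^] p \<in> N'"
      using pow subgroup_nat_pow_closed[OF N.subgroup_axioms] unfolding N'_def by simp
    then have "g [^] (p ^ Suc k) \<in> N'" using g by (simp add: nat_pow_pow mult.commute)
    then show ?thesis by blast
  qed
  then have "normal_p_index p G N'" using normal_p_index_iff[OF p] nor' fin by blast
  moreover have "X c \<inter> M \<subseteq> N'" for c
  proof
    fix y assume y: "y \<in> X c \<inter> M"
    then have yN: "y \<in> N" using MN unfolding refines_def by blast
    have "\<delta> y x = 0" if "x \<in> carrier G" for x
      using edge_cocycle_factor[OF \<delta>, of y c x] y that NE[of "inv y" x] yN by simp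
    then show "y \<in> N'" unfolding N'_def using yN by simp
  qed
  moreover have N'N: "N' \<subseteq> N" unfolding N'_def by blast
  moreover have "N \<subseteq> M" using MN unfolding refines_def by blast
  ultimately have "refines M N'" unfolding refines_def by blast
  moreover have "int p dvd \<delta> g x" if g: "g \<in> X b <#> N'" and x: "x \<in> carrier G" for g x
  proof -
    obtain a n where a: "a \<in> X b" "n \<in> N'" "g = a \<otimes> n" using g unfolding set_mult_def by blast
    have "\<delta> g x = \<delta> a x + \<delta> n (inv a \<otimes> x)"
      using mult a x X_carrier subgroup.mem_carrier[OF sub] by simp
    also have "\<delta> a x = 0" using edge_cocycle_factor[OF \<delta> a(1) x] by simp
    finally show ?thesis using a x X_carrier unfolding N'_def by simp
  qed
  ultimately show thesis using that[OF \<delta> _ N'N] by blast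
qed

lemma refines_refl: "normal_p_index p G M \<Longrightarrow> refines M M"
  by (auto simp: refines_def)

lemma refines_normal: "refines M N \<Longrightarrow> N \<lhd> G"
  unfolding refines_def using normal_p_index_normal by blast

text \<open>Among all refinements take one with the fewest pairs of positions at which the path of the word
  passes through the same edge modulo \<open>N\<close>. If such pairs remain, a closest one bounds a piece of the
  path that is closed and otherwise without repetition. The cocycle counts the second edge of this
  piece exactly once, so it is not divisible by \<open>p\<close> there, and the refinement defined by the cocycle
  separates this pair while creating no new ones.\<close>

lemma separate_partial_products:
  assumes M: "normal_p_index p G M" and w: "reduced (H <#> M) c w r"
  obtains N where "refines M N"
    "\<And>i j. i < j \<Longrightarrow> j \<le> r \<Longrightarrow> inv (word_prod w i) \<otimes> word_prod w j \<notin> H <#> N"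
proof -
  let ?P = "word_prod w"
  define bad where "bad N = {(i, j). i < j \<and> j \<le> r \<and> inv (?P i) \<otimes> ?P j \<in> H <#> N}" for N
  have fin: "finite (bad N)" for N
    by (rule finite_subset[of _ "{..r} \<times> {..r}"]) (auto simp: bad_def)
  have PG: "?P k \<in> carrier G" if "k \<le> r" for k using reduced_word_prod_carrier[OF w that] .
  obtain N where N: "refines M N" and min: "\<And>N'. refines M N' \<Longrightarrow> card (bad N) \<le> card (bad N')"
    using ex_has_least_nat[of "refines M" M "\<lambda>N. card (bad N)"] refines_refl[OF M] by blast
  have "bad N = {}"
  proof (rule ccontr)
    assume "bad N \<noteq> {}"
    then obtain i j where ij: "(i, j) \<in> bad N"
      and least: "\<And>k l. (k, l) \<in> bad N \<Longrightarrow> j - i \<le> l - k"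
      using ex_has_least_nat[of "\<lambda>x. x \<in> bad N" _ "\<lambda>(i, j). j - i"] by fast
    have ijr: "i < j" "j \<le> r" and ijE: "inv (?P i) \<otimes> ?P j \<in> H <#> N" using ij unfolding bad_def by auto
    let ?E = "H <#> N" and ?y = "?P (Suc i)"
    have E: "subgroup ?E G" using mult_normal_subgroup[OF refines_normal[OF N]] by blast
    have yG: "?y \<in> carrier G" using PG[of "Suc i"] ijr by linarith
    have letter: "w k \<notin> ?E" if "k < r" for k
      using reducedD(2)[OF w that] N unfolding refines_def set_mult_def by blast
    have step: "inv (?P i) \<otimes> ?y = w i"
      using PG[of i] ijr reduced_carrier[OF w order_less_le_trans[OF ijr]] by (simp add: m_assoc[symmetric])
    \<comment> \<open>A piece of one letter is not closed, because the letters avoid \<open>H M\<close>; so the position \<open>Suc i\<close>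
      at which the cocycle is evaluated is an interior one.\<close>
    have "j \<noteq> Suc i" using step letter ijE ijr by force
    with ijr have ij2: "Suc i < j" by simp
    have pos: "inv (?P k) \<otimes> ?y \<in> ?E \<longleftrightarrow> k = Suc i" if k: "i \<le> k" "k \<le> j" for k
    proof -
      consider "k = i" | "k = Suc i" | "Suc i < k" using k by linarith
      then show ?thesis
      proof cases
        case 1
        then show ?thesis using step letter ijr by simp
      next
        case 2
        then show ?thesis using yG subgroup.one_closed[OF E] by simp
      next
        case 3
        have "(Suc i, k) \<notin> bad N" using least[of "Suc i" k] 3 k ijr by auto
        then have "inv ?y \<otimes> ?P k \<notin> ?E" using 3 k ijr unfolding bad_def by auto
        moreover have "inv (inv (?P k) \<otimes> ?y) = inv ?y \<otimes> ?P k"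
          using PG k ijr yG by (simp add: inv_mult_group)
        ultimately have "inv (?P k) \<otimes> ?y \<notin> ?E" using subgroup.m_inv_closed[OF E] by metis
        then show ?thesis using 3 by simp
      qed
    qed
    obtain \<delta> N' where \<delta>: "edge_cocycle ?E True \<delta>" and N': "refines M N'" "N' \<subseteq> N"
      and dvd: "\<And>g x. g \<in> X True <#> N' \<Longrightarrow> x \<in> carrier G \<Longrightarrow> int p dvd \<delta> g x"
      using refine_by_cocycle[OF N] by metis
    let ?s = "\<lambda>k. letter_weight True c k * (of_bool (inv (?P k) \<otimes> ?y \<in> ?E) - of_bool (inv (?P (Suc k)) \<otimes> ?y \<in> ?E))"
    have "(i, j) \<notin> bad N'"
    proof
      assume "(i, j) \<in> bad N'"
      then have "inv (?P i) \<otimes> ?P j \<in> H <#> N'" unfolding bad_def by simp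
      then have "inv (?P i) \<otimes> ?P j \<in> X True <#> N'"
        using H_X unfolding set_mult_def by blast
      then have "int p dvd \<delta> (inv (?P i) \<otimes> ?P j) (inv (?P i) \<otimes> ?y)"
        using dvd PG ijr yG by simp
      also have "\<delta> (inv (?P i) \<otimes> ?P j) (inv (?P i) \<otimes> ?y) = \<delta> (?P j) ?y - \<delta> (?P i) ?y"
        using edge_cocycle_mult[OF \<delta>, of "?P i" "inv (?P i) \<otimes> ?P j" ?y] PG ijr yG
        by (simp add: m_assoc[symmetric])
      also have "\<dots> = (\<Sum>k<j. ?s k) - (\<Sum>k<i. ?s k)"
        using edge_cocycle_word_prod[OF \<delta> reduced_mono[OF w, of j] yG]
          edge_cocycle_word_prod[OF \<delta> reduced_mono[OF w, of i] yG] ijr by simp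
      also have "\<dots> = (\<Sum>k=i..<j. ?s k)"
        using ijr sum.atLeastLessThan_concat[of 0 i j ?s] by (simp add: atLeast0LessThan)
      also have "\<dots> = letter_weight True c (Suc i) - letter_weight True c i"
        using sum_single_position[of i "Suc i" j "\<lambda>k. inv (?P k) \<otimes> ?y \<in> ?E", OF _ _ pos] ij2 by simp
      \<comment> \<open>The two weights next to a position are 0 and 1 in some order, so this number is 1 or -1.\<close>
      finally have "int p dvd 1 - 2 * letter_weight True c i" by (simp add: letter_weight_Suc)
      then have "int p dvd 1" unfolding letter_weight_def by (cases "(even i = c) \<noteq> True") auto
      then show False using p by (metis int_dvd_int_iff not_prime_unit of_nat_1)
    qed
    moreover have "bad N' \<subseteq> bad N" using N'(2) unfolding bad_def set_mult_def by blast
    ultimately have "bad N' \<subset> bad N" using ij by blast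
    then have "card (bad N') < card (bad N)" using psubset_card_mono[OF fin] by blast
    then show False using min[OF N'(1)] by simp
  qed
  then show thesis using that[OF N] unfolding bad_def by blast
qed

end

section \<open>Separation from a factor, and residual finiteness\<close>

locale filtered_amalgam = amalgam +
  assumes factor_residual: "\<lbrakk>x \<in> X b; x \<noteq> \<one>\<rbrakk> \<Longrightarrow> \<exists>N. normal_p_index p G N \<and> x \<notin> N"
    and factor_separates_H: "\<lbrakk>x \<in> X b; x \<notin> H\<rbrakk> \<Longrightarrow> \<exists>N. normal_p_index p G N \<and> x \<notin> H <#> N"
begin

lemma reduced_modulo:
  assumes w: "reduced H c w r"
  shows "\<exists>M. normal_p_index p G M \<and> reduced (H <#> M) c w r"
proof -
  have "\<exists>M. normal_p_index p G M \<and> (\<forall>k<r. w k \<notin> H <#> M)"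
  proof (rule normal_p_index_common[OF p])
    show "\<exists>N. normal_p_index p G N \<and> w k \<notin> H <#> N" if "k < r" for k
      using factor_separates_H reducedD[OF w that] by blast
  qed (unfold set_mult_def, blast)
  then show ?thesis using w unfolding reduced_def by blast
qed

lemma same_coset_iff:
  assumes E: "subgroup E G" and P: "\<And>k. k \<le> r \<Longrightarrow> f k \<in> carrier G"
    and dist: "\<And>i j. i < j \<Longrightarrow> j \<le> r \<Longrightarrow> inv (f i) \<otimes> f j \<notin> E"
    and ij: "i \<le> r" "j \<le> (r::nat)"
  shows "inv (f i) \<otimes> f j \<in> E \<longleftrightarrow> i = j"
proof (cases i j rule: linorder_cases)
  case greater
  have "inv (inv (f i) \<otimes> f j) = inv (f j) \<otimes> f i" using P ij by (simp add: inv_mult_group)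
  then have "inv (f i) \<otimes> f j \<notin> E"
    using dist[OF greater] ij subgroup.m_inv_closed[OF E] by metis
  then show ?thesis using greater by simp
qed (use dist ij P subgroup.one_closed[OF E] in auto)

text \<open>Once the path of the reduced word of \<open>g\<close> has no repetitions, the cocycle of \<open>g\<close> takes the value 1
  at the first edge that moves away from the vertex of \<open>X b\<close>, whereas on \<open>X b N'\<close> it is divisible
  by \<open>p\<close>.\<close>

lemma separate_from_factor:
  assumes g: "g \<in> carrier G" "g \<notin> X b"
  shows "\<exists>N. normal_p_index p G N \<and> g \<notin> X b <#> N"
proof -
  obtain c w r where r: "0 < r" and w: "reduced H c w r" and gw: "g = word_prod w r"
    using reduced_form[OF g(1)] g(2) H_X by blast
  obtain M where M: "normal_p_index p G M" and wM: "reduced (H <#> M) c w r"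
    using reduced_modulo[OF w] by blast
  obtain N where N: "refines M N"
    and dist: "\<And>i j. i < j \<Longrightarrow> j \<le> r \<Longrightarrow> inv (word_prod w i) \<otimes> word_prod w j \<notin> H <#> N"
    using separate_partial_products[OF M wM] by metis
  obtain \<delta> N' where \<delta>: "edge_cocycle (H <#> N) b \<delta>" and N': "refines M N'"
    and dvd: "\<And>g x. g \<in> X b <#> N' \<Longrightarrow> x \<in> carrier G \<Longrightarrow> int p dvd \<delta> g x"
    using refine_by_cocycle[OF N] by metis
  have E: "subgroup (H <#> N) G" using mult_normal_subgroup[OF refines_normal[OF N]] by blast
  \<comment> \<open>The position of the first letter that is not in \<open>X b\<close>.\<close>
  define m :: nat where "m = (if c = b then 1 else 0)"
  have mr: "m < r"
  proof (rule ccontr)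
    assume "\<not> m < r"
    then have "r = 1" "c = b" using r unfolding m_def by (auto split: if_splits)
    then show False using g(2) gw reducedD[OF w, of 0] reduced_carrier[OF w, of 0] by simp
  qed
  have PG: "word_prod w k \<in> carrier G" if "k \<le> r" for k using reduced_word_prod_carrier[OF w that] .
  have pos: "inv (word_prod w k) \<otimes> word_prod w m \<in> H <#> N \<longleftrightarrow> k = m" if "k \<le> r" for k
    using same_coset_iff[OF E, where f = "word_prod w" and r = r, OF PG dist that] mr by simp
  have "g \<notin> X b <#> N'"
  proof
    assume "g \<in> X b <#> N'"
    then have "int p dvd \<delta> g (word_prod w m)" using dvd PG mr by simp
    also have "\<delta> g (word_prod w m) =
        letter_weight b c m - (if 0 < m then letter_weight b c (m - 1) else 0)"
      unfolding gw edge_cocycle_word_prod[OF \<delta> w PG[OF less_imp_le[OF mr]]] atLeast0LessThan[symmetric]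
      using sum_single_position[of 0 m r "\<lambda>k. inv (word_prod w k) \<otimes> word_prod w m \<in> H <#> N"] pos mr by simp
    also have "\<dots> = 1" unfolding m_def letter_weight_def by (cases b; cases c) auto
    finally show False using p by (metis int_dvd_int_iff not_prime_unit of_nat_1)
  qed
  then show ?thesis using N' unfolding refines_def by blast
qed

lemma residually_p:
  assumes g: "g \<in> carrier G" "g \<noteq> \<one>"
  shows "\<exists>N. normal_p_index p G N \<and> g \<notin> N"
proof (cases "g \<in> X True")
  case True
  then show ?thesis using factor_residual g by blast
next
  case False
  then obtain N where N: "normal_p_index p G N" "g \<notin> X True <#> N" using separate_from_factor g by blast
  have "N \<subseteq> X True <#> N"
    using subgroup.one_closed[OF subX] subgroup.mem_carrier[OF normal_imp_subgroup[OF normal_p_index_normal[OF N(1)]]]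
    unfolding set_mult_def by force
  then show ?thesis using N by blast
qed

end

section \<open>Cyclically reduced words\<close>

context two_factors
begin

lemma word_prod_add:
  "(\<And>k. w k \<in> carrier G) \<Longrightarrow> word_prod w (n + i) = word_prod w n \<otimes> word_prod (\<lambda>k. w (n + k)) i"
  by (induction i) (simp_all add: word_prod_carrier m_assoc)

lemma reduced_periodic:
  assumes "reduced E b w L" "even L" "0 < L"
  shows "reduced E b (\<lambda>k. w (k mod L)) r"
  unfolding reduced_def
proof (intro allI impI)
  fix k
  have "k mod L < L" "even (k mod L) = even k" using assms by (auto simp: dvd_mod_iff)
  moreover from this(1) have "w (k mod L) \<in> X (even (k mod L) = b) - E"
    using assms(1) unfolding reduced_def by blast
  ultimately show "w (k mod L) \<in> X (even k = b) - E" by (simp only:)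
qed

lemma word_prod_periodic:
  assumes w: "reduced E b w L" and L: "0 < L" and i: "i \<le> L"
  shows "word_prod (\<lambda>k. w (k mod L)) (q * L + i) = word_prod w L [^] q \<otimes> word_prod w i"
proof -
  let ?u = "\<lambda>k. w (k mod L)"
  have uG: "?u k \<in> carrier G" for k using reduced_carrier[OF w] L by simp
  have one_period: "word_prod (\<lambda>k. ?u (q * L + k)) i = word_prod w i" if "i \<le> L" for q i
    using that by (intro word_prod_cong) simp
  have "word_prod ?u (q * L) = word_prod w L [^] q" for q
  proof (induction q)
    case (Suc q)
    have "word_prod ?u (Suc q * L) = word_prod ?u (q * L + L)" by (simp add: add.commute)
    also have "\<dots> = word_prod ?u (q * L) \<otimes> word_prod w L"
      using word_prod_add[of ?u "q * L" L] uG one_period[of L q] by simp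
    finally show ?case using Suc by simp
  qed simp
  then show ?thesis using word_prod_add[of ?u "q * L" i] uG one_period[OF i] by simp
qed

end

context filtered_amalgam
begin

text \<open>The powers of a cyclically reduced word are reduced words, so their paths can be opened up
  without changing the images of the factors.\<close>

lemma hyperbolic_unbounded_order:
  assumes w: "reduced H b w L" and L: "even L" "0 < L"
  shows "\<exists>M. normal_p_index p G M \<and> (\<forall>k. \<exists>N. refines M N \<and> word_prod w L [^] (p ^ k) \<notin> N)"
proof -
  obtain M where M: "normal_p_index p G M" and wM: "reduced (H <#> M) b w L"
    using reduced_modulo[OF w] by blast
  have "\<exists>N. refines M N \<and> word_prod w L [^] (p ^ k) \<notin> N" for k
  proof -
    let ?u = "\<lambda>k. w (k mod L)" and ?r = "p ^ k * L"
    obtain N where N: "refines M N"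
      and dist: "\<And>i j. i < j \<Longrightarrow> j \<le> ?r \<Longrightarrow> inv (word_prod ?u i) \<otimes> word_prod ?u j \<notin> H <#> N"
      using separate_partial_products[OF M reduced_periodic[OF wM L]] by metis
    have PL: "word_prod w L \<in> carrier G" using reduced_word_prod_carrier[OF w] by simp
    have "word_prod ?u ?r = word_prod w L [^] (p ^ k)"
      using word_prod_periodic[OF w L(2), of 0 "p ^ k"] PL by simp
    moreover have "0 < ?r" using L prime_gt_0_nat[OF p] by simp
    ultimately have "word_prod w L [^] (p ^ k) \<notin> H <#> N"
      using dist[of 0 ?r] PL by simp
    then show ?thesis using N mult_normal_subgroup(3)[OF refines_normal[OF N]] by blast
  qed
  then show ?thesis using M by blast
qed

lemma periodic_cosets_distinct:
  assumes w: "reduced H b w L" and L: "even L" "0 < L"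
  shows "inv (word_prod (\<lambda>k. w (k mod L)) i) \<otimes> word_prod (\<lambda>k. w (k mod L)) j \<in> H \<longleftrightarrow> i = j"
proof -
  let ?u = "\<lambda>k. w (k mod L)" and ?r = "max i j"
  have PG: "word_prod ?u k \<in> carrier G" for k
    using reduced_word_prod_carrier[OF reduced_periodic[OF w L]] by blast
  obtain M where M: "normal_p_index p G M" and wM: "reduced (H <#> M) b w L"
    using reduced_modulo[OF w] by blast
  obtain N where N: "refines M N"
    and dist: "\<And>i j. i < j \<Longrightarrow> j \<le> ?r \<Longrightarrow> inv (word_prod ?u i) \<otimes> word_prod ?u j \<notin> H <#> N"
    using separate_partial_products[OF M reduced_periodic[OF wM L]] by metis
  have "H \<subseteq> H <#> N" using mult_normal_subgroup(2)[OF refines_normal[OF N]] .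
  then show ?thesis
    using same_coset_iff[OF subH, of ?r "word_prod ?u" i j] PG dist by auto
qed

end

context two_factors
begin

text \<open>Membership of \<open>inv s \<otimes> x\<close> in \<open>H\<close> says that \<open>x\<close> and \<open>s\<close> define the same edge.\<close>

lemma edge_cocycle_finite_support:
  assumes \<delta>: "edge_cocycle H b \<delta>" and g: "g \<in> carrier G"
  shows "\<exists>S. finite S \<and> S \<subseteq> carrier G \<and> (\<forall>x\<in>carrier G. \<delta> g x \<noteq> 0 \<longrightarrow> (\<exists>s\<in>S. inv s \<otimes> x \<in> H))"
  using g
proof (rule factors_induct)
  show "\<exists>S. finite S \<and> S \<subseteq> carrier G \<and> (\<forall>x\<in>carrier G. \<delta> \<one> x \<noteq> 0 \<longrightarrow> (\<exists>s\<in>S. inv s \<otimes> x \<in> H))"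
    using edge_cocycle_one[OF \<delta>] by (intro exI[of _ "{}"]) simp
  fix g c y
  assume g: "g \<in> carrier G" and y: "y \<in> X c"
    and "\<exists>S. finite S \<and> S \<subseteq> carrier G \<and> (\<forall>x\<in>carrier G. \<delta> g x \<noteq> 0 \<longrightarrow> (\<exists>s\<in>S. inv s \<otimes> x \<in> H))"
  then obtain S where S: "finite S" "S \<subseteq> carrier G"
    "\<And>x. x \<in> carrier G \<Longrightarrow> \<delta> g x \<noteq> 0 \<Longrightarrow> \<exists>s\<in>S. inv s \<otimes> x \<in> H" by blast
  have yG: "y \<in> carrier G" using y by (rule X_carrier)
  have "\<exists>s\<in>insert g (insert (g \<otimes> y) S). inv s \<otimes> x \<in> H"
    if x: "x \<in> carrier G" and nz: "\<delta> (g \<otimes> y) x \<noteq> 0" for x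
  proof (cases "\<delta> g x = 0")
    case True
    then have "\<delta> y (inv g \<otimes> x) \<noteq> 0" using nz edge_cocycle_mult[OF \<delta> g yG x] by simp
    then have "inv g \<otimes> x \<in> H \<or> inv y \<otimes> (inv g \<otimes> x) \<in> H"
      using edge_cocycle_factor[OF \<delta> y, of "inv g \<otimes> x"] g x by (auto split: if_splits)
    moreover have "inv y \<otimes> (inv g \<otimes> x) = inv (g \<otimes> y) \<otimes> x"
      using g x yG by (simp add: inv_mult_group m_assoc)
    ultimately show ?thesis by auto
  qed (use S x in blast)
  then show "\<exists>S. finite S \<and> S \<subseteq> carrier G \<and> (\<forall>x\<in>carrier G. \<delta> (g \<otimes> y) x \<noteq> 0 \<longrightarrow> (\<exists>s\<in>S. inv s \<otimes> x \<in> H))"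
    using S g yG by (intro exI[of _ "insert g (insert (g \<otimes> y) S)"]) simp
qed

end

context group
begin

lemma inv_mult_cancel: "x \<in> carrier G \<Longrightarrow> y \<in> carrier G \<Longrightarrow> inv x \<otimes> (x \<otimes> y) = y"
  by (simp flip: m_assoc)

lemma inv_mult_common_left:
  "\<lbrakk>x \<in> carrier G; y \<in> carrier G; z \<in> carrier G\<rbrakk> \<Longrightarrow> inv (x \<otimes> y) \<otimes> (x \<otimes> z) = inv y \<otimes> z"
  by (simp add: inv_mult_group m_assoc inv_mult_cancel)

lemma commute_int_pow:
  assumes "g \<in> carrier G" "c \<in> carrier G" "g \<otimes> c = c \<otimes> g"
  shows "g \<otimes> c [^] (j::int) = c [^] j \<otimes> g"
proof -
  let ?Z = "{x \<in> carrier G. g \<otimes> x = x \<otimes> g}"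
  have "subgroup ?Z G"
  proof (rule subgroupI)
    show "?Z \<noteq> {}" using assms by blast
    fix x assume x: "x \<in> ?Z"
    have xG: "x \<in> carrier G" and gx: "g \<otimes> x = x \<otimes> g" using x by auto
    have "inv x \<otimes> g = inv x \<otimes> (g \<otimes> x) \<otimes> inv x" using xG assms by (simp add: m_assoc)
    also have "\<dots> = g \<otimes> inv x" unfolding gx using xG assms by (simp flip: m_assoc)
    finally have "g \<otimes> inv x = inv x \<otimes> g" ..
    then show "inv x \<in> ?Z" using x by simp
    fix y assume "y \<in> ?Z"
    then have yG: "y \<in> carrier G" and gy: "g \<otimes> y = y \<otimes> g" by auto
    have "g \<otimes> (x \<otimes> y) = x \<otimes> (g \<otimes> y)" using xG yG assms gx by (simp flip: m_assoc)
    then show "x \<otimes> y \<in> ?Z" using xG yG assms gy by (simp add: m_assoc)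
  qed simp
  then show ?thesis using subgroup_int_pow_closed[of ?Z c j] assms by simp
qed

lemma commute_nat_pow:
  assumes "g \<in> carrier G" "c \<in> carrier G" "g \<otimes> c = c \<otimes> g"
  shows "g [^] (m::nat) \<otimes> c [^] (j::int) = c [^] j \<otimes> g [^] m"
  using commute_int_pow[of "c [^] j" g "int m"] commute_int_pow[OF assms] assms
  by (simp add: int_pow_int)

end

context filtered_amalgam
begin

text \<open>The edges \<open>c\<^sup>j P\<^sub>i H\<close>, where \<open>P\<^sub>i\<close> are the partial products of the word \<open>c\<close>, form the axis of \<open>c\<close>.
  Compare the two expansions of the cocycle on \<open>g d = d g\<close>, where \<open>d\<close> is a high power of \<open>c\<close>: the
  translate by \<open>g\<close> of a long segment of the axis agrees with that segment except for the paths
  of \<open>g\<close> at both ends, whose number of edges does not grow with \<open>d\<close>. So some edge of the segment, and by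
  commutation also the edge \<open>P\<^sub>1 H\<close>, is mapped into the axis.\<close>

lemma commuting_maps_axis:
  assumes w: "reduced H b w L" and L: "even L" "0 < L"
    and g: "g \<in> carrier G" and comm: "g \<otimes> word_prod w L = word_prod w L \<otimes> g"
  shows "\<exists>(j::int). \<exists>i<L. inv (word_prod w L [^] j \<otimes> word_prod w i) \<otimes> (g \<otimes> word_prod w 1) \<in> H"
proof -
  let ?u = "\<lambda>k. w (k mod L)" and ?c = "word_prod w L" and ?P = "word_prod (\<lambda>k. w (k mod L))"
  have L2: "1 < L" using L by (cases "L = 1") auto
  have cG: "?c \<in> carrier G" using reduced_word_prod_carrier[OF w] by simp
  have wG: "word_prod w i \<in> carrier G" if "i \<le> L" for i using reduced_word_prod_carrier[OF w that] .
  have PG: "?P k \<in> carrier G" for k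
    using reduced_word_prod_carrier[OF reduced_periodic[OF w L]] by blast
  note dist = periodic_cosets_distinct[OF w L]
  obtain \<delta> where \<delta>: "edge_cocycle H True \<delta>" using edge_cocycle_exists[OF subH order_refl] by blast
  obtain S where S: "finite S" "S \<subseteq> carrier G"
    "\<And>x. x \<in> carrier G \<Longrightarrow> \<delta> g x \<noteq> 0 \<Longrightarrow> \<exists>s\<in>S. inv s \<otimes> x \<in> H"
    using edge_cocycle_finite_support[OF \<delta> g] by blast
  \<comment> \<open>One more than the number of edges that the two end paths can hide.\<close>
  define n where "n = 2 * card S + 1"
  define z where "z q = g \<otimes> ?P (q * L + 1)" for q
  define d where "d = ?c [^] n"
  have dP: "d = ?P (n * L)" unfolding d_def using word_prod_periodic[OF w L(2), of 0 n] cG by simp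
  have dG: "d \<in> carrier G" unfolding d_def using cG by simp
  have zG: "z q \<in> carrier G" for q unfolding z_def by (rule m_closed[OF g PG])
  have gd: "g \<otimes> d = d \<otimes> g" unfolding d_def
    using commute_int_pow[OF g cG comm, of "int n"] by (simp add: int_pow_int)
  have path: "\<delta> d y = (\<Sum>k=0..<n * L. letter_weight True b k *
      (of_bool (inv (?P k) \<otimes> y \<in> H) - of_bool (inv (?P (Suc k)) \<otimes> y \<in> H)))"
    if "y \<in> carrier G" for y
    unfolding dP using edge_cocycle_word_prod[OF \<delta> reduced_periodic[OF w L] that, of "n * L"]
    by (simp only: atLeast0LessThan)
  have nz: "\<delta> d z \<noteq> 0 \<or> \<delta> g z \<noteq> 0 \<or> \<delta> g (inv d \<otimes> z) \<noteq> 0"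
    if q: "q < n" and z: "z = g \<otimes> ?P (q * L + 1)" for q z
  proof -
    let ?m = "q * L + 1"
    have "Suc q * L \<le> n * L" using q by (intro mult_le_mono1) simp
    then have m: "?m < n * L" using L2 by simp
    have "\<delta> d (?P ?m) = letter_weight True b ?m - letter_weight True b (?m - 1)"
      unfolding path[OF PG]
      using sum_single_position[of 0 ?m "n * L" "\<lambda>k. inv (?P k) \<otimes> ?P ?m \<in> H"] dist m
      by (simp del: word_prod.simps)
    then have "\<delta> d (?P ?m) \<noteq> 0"
      using letter_weight_Suc[of True b "q * L"] unfolding letter_weight_def by auto
    moreover have zc: "z \<in> carrier G" unfolding z by (rule m_closed[OF g PG])
    moreover have "inv g \<otimes> z = ?P ?m" unfolding z by (rule inv_mult_cancel[OF g PG])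
    moreover have "\<delta> (g \<otimes> d) z = \<delta> (d \<otimes> g) z" using gd by simp
    ultimately show ?thesis
      using edge_cocycle_mult[OF \<delta> g dG, of z] edge_cocycle_mult[OF \<delta> dG g, of z] by auto
  qed
  have "\<exists>q<n. \<delta> d (z q) \<noteq> 0"
  proof (rule ccontr)
    assume no: "\<not> ?thesis"
    define T where "T = S \<union> (\<lambda>s. d \<otimes> s) ` S"
    have TG: "T \<subseteq> carrier G" unfolding T_def using S(2) dG by auto
    have "card T \<le> card S + card ((\<lambda>s. d \<otimes> s) ` S)" unfolding T_def by (rule card_Un_le)
    also have "\<dots> \<le> card S + card S" using card_image_le[OF S(1)] by simp
    finally have cT: "card T < n" unfolding n_def by simp
    have "\<exists>t\<in>T. inv t \<otimes> z q \<in> H" if q: "q < n" for q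
    proof -
      have "\<delta> g (z q) \<noteq> 0 \<or> \<delta> g (inv d \<otimes> z q) \<noteq> 0" using nz[OF q z_def] no q by blast
      then consider s where "s \<in> S" "inv s \<otimes> z q \<in> H" | s where "s \<in> S" "inv s \<otimes> (inv d \<otimes> z q) \<in> H"
        using S(3) zG dG by (metis inv_closed m_closed)
      then show ?thesis
      proof cases
        case 1
        then show ?thesis unfolding T_def by blast
      next
        case 2
        have "inv (d \<otimes> s) \<otimes> z q = inv s \<otimes> (inv d \<otimes> z q)"
          using 2(1) S(2) dG zG by (simp add: subset_iff inv_mult_group m_assoc)
        then have "inv (d \<otimes> s) \<otimes> z q \<in> H" using 2(2) by (simp only:)
        moreover have "d \<otimes> s \<in> T" unfolding T_def using 2(1) by blast
        ultimately show ?thesis by blast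
      qed
    qed
    then obtain t where t: "\<And>q. q < n \<Longrightarrow> t q \<in> T \<and> inv (t q) \<otimes> z q \<in> H" by metis
    have "\<not> inj_on t {..<n}"
    proof
      assume "inj_on t {..<n}"
      then have "n \<le> card T" using card_inj_on_le[of t "{..<n}" T] t S(1) unfolding T_def by auto
      then show False using cT by simp
    qed
    then obtain q q' where qq: "q < n" "q' < n" "q \<noteq> q'" "t q = t q'" unfolding inj_on_def by auto
    have tG: "t q \<in> carrier G" using t[OF qq(1)] TG by blast
    have "inv (inv (t q) \<otimes> z q) \<otimes> (inv (t q) \<otimes> z q') \<in> H"
      using t[OF qq(1)] t[OF qq(2)] qq(4) H_mult H_inv by simp
    also have "inv (inv (t q) \<otimes> z q) \<otimes> (inv (t q) \<otimes> z q') = inv (z q) \<otimes> (t q \<otimes> (inv (t q) \<otimes> z q'))"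
      using tG zG by (simp add: inv_mult_group m_assoc)
    also have "t q \<otimes> (inv (t q) \<otimes> z q') = z q'"
      using tG zG by (simp add: m_assoc[symmetric])
    also have "inv (z q) \<otimes> z q' = inv (?P (q * L + 1)) \<otimes> ?P (q' * L + 1)"
      unfolding z_def by (rule inv_mult_common_left[OF g PG PG])
    finally have "q * L + 1 = q' * L + 1" by (simp only: dist)
    then show False using qq(3) L by simp
  qed
  then obtain q where q: "q < n" "\<delta> d (z q) \<noteq> 0" by blast
  have "\<exists>k. inv (?P k) \<otimes> z q \<in> H"
  proof (rule ccontr)
    assume "\<not> ?thesis"
    then have "\<delta> d (z q) = 0" unfolding path[OF zG] by (simp del: word_prod.simps)
    then show False using q by simp
  qed
  then obtain k where k: "inv (?P k) \<otimes> z q \<in> H" by blast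
  define a i where "a = k div L" and "i = k mod L"
  have iL: "i < L" unfolding i_def using L by simp
  have Pk: "?P k = ?c [^] a \<otimes> word_prod w i"
    using word_prod_periodic[OF w L(2), of i a] iL unfolding a_def i_def by simp
  have "?P (q * L + 1) = ?c [^] q \<otimes> word_prod w 1"
    using word_prod_periodic[OF w L(2), of 1 q] L2 by simp
  then have "z q = g \<otimes> (?c [^] int q) \<otimes> word_prod w 1"
    unfolding z_def using g cG wG[of 1] L2 by (simp add: int_pow_int m_assoc)
  also have "\<dots> = ?c [^] int q \<otimes> (g \<otimes> word_prod w 1)"
    using commute_int_pow[OF g cG comm, of "int q"] g cG wG[of 1] L2 by (simp add: m_assoc)
  finally have zq: "z q = ?c [^] int q \<otimes> (g \<otimes> word_prod w 1)" .
  have "?c [^] int a = ?c [^] int q \<otimes> ?c [^] (int a - int q)"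
    using cG by (simp flip: int_pow_mult)
  then have "?P k = ?c [^] int q \<otimes> (?c [^] (int a - int q) \<otimes> word_prod w i)"
    unfolding Pk using cG wG[of i] iL by (simp add: int_pow_int m_assoc)
  then have "inv (?P k) \<otimes> z q = inv (?c [^] (int a - int q) \<otimes> word_prod w i) \<otimes>
      (inv (?c [^] int q) \<otimes> (?c [^] int q \<otimes> (g \<otimes> word_prod w 1)))"
    unfolding zq using cG wG[of i] wG[of 1] iL L2 g by (simp add: inv_mult_group m_assoc)
  also have "inv (?c [^] int q) \<otimes> (?c [^] int q \<otimes> (g \<otimes> word_prod w 1)) = g \<otimes> word_prod w 1"
    using cG g wG[of 1] L2 by (simp add: m_assoc[symmetric])
  finally show ?thesis using k iL by auto
qed

text \<open>Modulo \<open>c\<close> the axis has only \<open>L\<close> edges, so two of the first \<open>L + 1\<close> powers of \<open>g\<close> send the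
  edge \<open>P\<^sub>1 H\<close> into the same orbit; the fixed edge puts their quotient into a conjugate of \<open>H\<close>.\<close>

lemma commuting_power_fixes_edge:
  assumes w: "reduced H b w L" and L: "even L" "0 < L"
    and g: "g \<in> carrier G" and comm: "g \<otimes> word_prod w L = word_prod w L \<otimes> g"
  shows "\<exists>m>0. \<exists>(l::int). \<exists>t\<in>carrier G. \<exists>h\<in>H. g [^] (m::nat) \<otimes> word_prod w L [^] l = t \<otimes> h \<otimes> inv t"
proof -
  let ?c = "word_prod w L" and ?t = "word_prod w 1"
  have cG: "?c \<in> carrier G" using reduced_word_prod_carrier[OF w] by simp
  have wG: "word_prod w i \<in> carrier G" if "i \<le> L" for i using reduced_word_prod_carrier[OF w that] .
  have tG: "?t \<in> carrier G" using wG[of 1] L by simp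
  have "\<exists>j::int. \<exists>i<L. inv (?c [^] j \<otimes> word_prod w i) \<otimes> (g [^] m \<otimes> ?t) \<in> H" for m :: nat
    using commuting_maps_axis[OF w L, of "g [^] m"] g commute_nat_pow[OF g cG comm, of m 1] cG by simp
  then obtain j i where ij: "\<And>m::nat. i m < L"
    "\<And>m. inv (?c [^] (j m :: int) \<otimes> word_prod w (i m)) \<otimes> (g [^] m \<otimes> ?t) \<in> H" by metis
  have "\<not> inj_on i {..L}"
  proof
    assume "inj_on i {..L}"
    then have "card {..L} \<le> card {..<L}" using ij(1) by (intro card_inj_on_le[of i]) auto
    then show False by simp
  qed
  then obtain m m' where mm: "m < m'" "i m = i m'" unfolding inj_on_def by (metis linorder_neqE_nat)
  define s x where "s = word_prod w (i m)" and "x k = inv (?c [^] j k) \<otimes> g [^] k" for k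
  have sG: "s \<in> carrier G" unfolding s_def using wG ij(1)[of m] by simp
  have xG: "x k \<in> carrier G" for k unfolding x_def using g cG by simp
  have A: "inv s \<otimes> (x k \<otimes> ?t) \<in> H" if "i k = i m" for k
    using ij(2)[of k] that sG cG g tG unfolding s_def x_def by (simp add: inv_mult_group m_assoc)
  define h where "h = inv (inv s \<otimes> (x m \<otimes> ?t)) \<otimes> (inv s \<otimes> (x m' \<otimes> ?t))"
  have h: "h \<in> H" unfolding h_def using A mm H_mult H_inv by simp
  have "h = inv ?t \<otimes> (inv (x m) \<otimes> (s \<otimes> (inv s \<otimes> (x m' \<otimes> ?t))))"
    unfolding h_def using sG xG tG by (simp add: inv_mult_group m_assoc)
  also have "s \<otimes> (inv s \<otimes> (x m' \<otimes> ?t)) = x m' \<otimes> ?t"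
    using sG xG tG by (simp add: m_assoc[symmetric])
  finally have "?t \<otimes> h = ?t \<otimes> (inv ?t \<otimes> (inv (x m) \<otimes> (x m' \<otimes> ?t)))" by simp
  also have "\<dots> = inv (x m) \<otimes> (x m' \<otimes> ?t)" using xG tG by (simp add: m_assoc[symmetric])
  finally have "?t \<otimes> h \<otimes> inv ?t = inv (x m) \<otimes> x m'" using xG tG by (simp add: m_assoc)
  also have "\<dots> = inv (g [^] m) \<otimes> (?c [^] j m \<otimes> (?c [^] (- j m') \<otimes> g [^] m'))"
    unfolding x_def using g cG by (simp add: inv_mult_group int_pow_neg m_assoc)
  also have "?c [^] j m \<otimes> (?c [^] (- j m') \<otimes> g [^] m') = ?c [^] (j m - j m') \<otimes> g [^] m'"
    using g cG by (simp add: m_assoc[symmetric] int_pow_mult[symmetric])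
  also have "\<dots> = g [^] m' \<otimes> ?c [^] (j m - j m')" using commute_nat_pow[OF g cG comm] by simp
  also have "g [^] m' = g [^] m \<otimes> g [^] (m' - m)" using mm g by (simp add: nat_pow_mult)
  also have "inv (g [^] m) \<otimes> (g [^] m \<otimes> g [^] (m' - m) \<otimes> ?c [^] (j m - j m')) =
      g [^] (m' - m) \<otimes> ?c [^] (j m - j m')"
    using g cG by (simp add: m_assoc[symmetric])
  finally have "g [^] (m' - m) \<otimes> ?c [^] (j m - j m') = ?t \<otimes> h \<otimes> inv ?t" ..
  moreover have "0 < m' - m" using mm by simp
  ultimately show ?thesis using tG h by blast
qed

end

section \<open>Separation from cyclic subgroups\<close>

context group
begin

lemma isolated_coprime_power:
  fixes p m :: nat
  assumes iso: "p'_isolated p G C" and y: "y \<in> carrier G"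
    and m: "\<not> p dvd m" "y [^] m \<in> C"
  shows "y \<in> C"
  using m
proof (induction m rule: less_induct)
  case (less m)
  show ?case
  proof (cases "m = 1")
    case True
    then show ?thesis using less.prems y by simp
  next
    case False
    then obtain q where q: "prime q" "q dvd m" using prime_factor_nat by blast
    then obtain k where k: "m = k * q" by (metis dvd_def mult.commute)
    have m0: "m \<noteq> 0" using less.prems(1) by (metis dvd_0_right)
    have "q \<noteq> p" "\<not> p dvd k" using less.prems(1) q k by auto
    moreover have "(y [^] k) [^] q \<in> C" using less.prems(2) k y by (simp add: nat_pow_pow)
    ultimately have "y [^] k \<in> C" using iso q(1) y unfolding p'_isolated_def by (metis nat_pow_closed)
    moreover have "k < m" using m0 prime_gt_1_nat[OF q(1)] unfolding k by simp
    ultimately show ?thesis using less.IH \<open>\<not> p dvd k\<close> by blast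
  qed
qed

lemma nat_pow_conj:
  assumes "t \<in> carrier G" "a \<in> carrier G"
  shows "(t \<otimes> a \<otimes> inv t) [^] (n::nat) = t \<otimes> a [^] n \<otimes> inv t"
proof (induction n)
  case (Suc n)
  have "t \<otimes> a [^] n \<otimes> inv t \<otimes> (t \<otimes> a \<otimes> inv t) = t \<otimes> a [^] n \<otimes> (inv t \<otimes> (t \<otimes> (a \<otimes> inv t)))"
    using assms by (simp add: m_assoc)
  also have "\<dots> = t \<otimes> a [^] Suc n \<otimes> inv t"
    using assms by (simp add: inv_mult_cancel m_assoc)
  finally show ?case using Suc by simp
qed (use assms in simp)

end

context amalgam
begin

text \<open>The order of \<open>x\<close> has a bound that depends only on the images of the factors. This substitutes
  for fixing a vertex of the tree: it is invariant under conjugation and passes to \<open>p\<close>-th roots.\<close>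

definition bounded_order :: "'a \<Rightarrow> bool" where
  "bounded_order x \<longleftrightarrow>
    (\<forall>M. normal_p_index p G M \<longrightarrow> (\<exists>k. \<forall>N. refines M N \<longrightarrow> x [^] (p ^ k) \<in> N))"

text \<open>A power of \<open>a\<close> that lies in \<open>M\<close> lies in every refinement, because refinements keep the
  intersections with the factors.\<close>

lemma bounded_order_conj_factor:
  assumes t: "t \<in> carrier G" and a: "a \<in> X b"
  shows "bounded_order (t \<otimes> a \<otimes> inv t)"
  unfolding bounded_order_def
proof (intro allI impI)
  fix M assume M: "normal_p_index p G M"
  have aG: "a \<in> carrier G" using a by (rule X_carrier)
  obtain k where k: "a [^] (p ^ k) \<in> M" using M aG unfolding normal_p_index_iff[OF p] by blast
  have "(t \<otimes> a \<otimes> inv t) [^] (p ^ k) \<in> N" if N: "refines M N" for N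
  proof -
    interpret N: normal N G by (rule refines_normal[OF N])
    have "a [^] (p ^ k) \<in> N"
      using N k subgroup_nat_pow_closed[OF subX a] unfolding refines_def by blast
    then show ?thesis using N.inv_op_closed2[OF t] by (simp add: nat_pow_conj[OF t aG])
  qed
  then show "\<exists>k. \<forall>N. refines M N \<longrightarrow> (t \<otimes> a \<otimes> inv t) [^] (p ^ k) \<in> N" by blast
qed

lemma bounded_order_root:
  assumes y: "y \<in> carrier G" and "bounded_order (y [^] p)"
  shows "bounded_order y"
  unfolding bounded_order_def
proof (intro allI impI)
  fix M assume "normal_p_index p G M"
  then obtain k where "\<And>N. refines M N \<Longrightarrow> (y [^] p) [^] (p ^ k) \<in> N"
    using assms(2) unfolding bounded_order_def by blast
  then have "\<forall>N. refines M N \<longrightarrow> y [^] (p ^ Suc k) \<in> N" using y by (simp add: nat_pow_pow)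
  then show "\<exists>k. \<forall>N. refines M N \<longrightarrow> y [^] (p ^ k) \<in> N" by blast
qed

lemma refines_Int:
  assumes "refines M N" and K: "normal_p_index p G K"
  shows "refines (M \<inter> K) (N \<inter> K)"
  using assms normal_p_index_Int[OF p _ K] unfolding refines_def by blast

end

context filtered_amalgam
begin

lemma separate_from_cyclically_reduced:
  assumes w: "reduced H b w L" and L: "even L" "0 < L"
    and iso: "p'_isolated p G (generate G {word_prod w L})"
    and g: "g \<in> carrier G" "g \<notin> generate G {word_prod w L}"
  shows "\<exists>N. normal_p_index p G N \<and> g \<notin> generate G {word_prod w L} <#> N"
proof -
  define c where "c = word_prod w L"
  have cG: "c \<in> carrier G" unfolding c_def using reduced_word_prod_carrier[OF w] by simp
  have gen: "generate G {c} = {c [^] i | i :: int. i \<in> UNIV}" by (rule generate_pow[OF cG])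
  have memE: "\<exists>(i::int) n. n \<in> N \<and> g = c [^] i \<otimes> n" if "g \<in> generate G {c} <#> N" for N
    using that unfolding gen set_mult_def by blast
  show ?thesis
  proof (cases "g \<otimes> c = c \<otimes> g")
    case False
    \<comment> \<open>Were \<open>g\<close> congruent to a power of \<open>c\<close>, the commutator would lie in \<open>N\<close>.\<close>
    define x where "x = g \<otimes> c \<otimes> inv g \<otimes> inv c"
    have xG: "x \<in> carrier G" unfolding x_def using g cG by simp
    have "x \<noteq> \<one>"
    proof
      assume "x = \<one>"
      then have "g \<otimes> c \<otimes> inv g = c" unfolding x_def using g cG
        by (metis inv_closed inv_equality inv_inv m_closed)
      then have "g \<otimes> c = c \<otimes> g" using g cG by (metis inv_closed inv_solve_right' m_closed)
      then show False using False by simp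
    qed
    then obtain N where N: "normal_p_index p G N" "x \<notin> N" using residually_p xG by blast
    interpret N: normal N G by (rule normal_p_index_normal[OF N(1)])
    have "g \<notin> generate G {c} <#> N"
    proof
      assume "g \<in> generate G {c} <#> N"
      then obtain i :: int and n where n: "n \<in> N" "g = c [^] i \<otimes> n" using memE by blast
      have nG: "n \<in> carrier G" using n by simp
      have "n \<otimes> (c \<otimes> inv n \<otimes> inv c) \<in> N" using n cG N.inv_op_closed2[OF cG, of "inv n"] by simp
      then have mem: "c [^] i \<otimes> (n \<otimes> (c \<otimes> inv n \<otimes> inv c)) \<otimes> inv (c [^] i) \<in> N"
        using N.inv_op_closed2 cG by simp
      have "inv c \<otimes> inv (c [^] i) = inv (c [^] i) \<otimes> inv c"
        using commute_int_pow[OF cG cG HOL.refl, of i] cG by (simp flip: inv_mult_group)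
      then have "c [^] i \<otimes> (n \<otimes> (c \<otimes> inv n \<otimes> inv c)) \<otimes> inv (c [^] i) = x"
        unfolding x_def n(2) using nG cG by (simp add: inv_mult_group m_assoc)
      then show False using mem N(2) by simp
    qed
    then show ?thesis using N(1) unfolding c_def by blast
  next
    case comm: True
    have "\<exists>m>0. \<exists>l::int. bounded_order (g [^] (m::nat) \<otimes> c [^] l)"
    proof -
      obtain m l t h where "0 < (m::nat)" "t \<in> carrier G" "h \<in> H"
        "g [^] m \<otimes> c [^] (l::int) = t \<otimes> h \<otimes> inv t"
        using commuting_power_fixes_edge[OF w L g(1)] comm unfolding c_def by blast
      then show ?thesis using bounded_order_conj_factor H_X by metis
    qed
    then have ex: "\<exists>m. 0 < m \<and> (\<exists>l::int. bounded_order (g [^] (m::nat) \<otimes> c [^] l))" by blast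
    \<comment> \<open>Elements of bounded order play the part of the elements fixing a point of the axis, and the
      least \<open>m\<close> that of a generator of the translations modulo \<open>c\<close>.\<close>
    define m where "m = (LEAST m. 0 < m \<and> (\<exists>l::int. bounded_order (g [^] (m::nat) \<otimes> c [^] l)))"
    have m0: "0 < m" and "\<exists>l::int. bounded_order (g [^] m \<otimes> c [^] l)"
      using LeastI_ex[OF ex] unfolding m_def by blast+
    then obtain l :: int where l: "bounded_order (g [^] m \<otimes> c [^] l)" by blast
    have least: "\<not> bounded_order (g [^] k \<otimes> c [^] l')" if "0 < k" "k < m" for k :: nat and l' :: int
      using not_less_Least[of k "\<lambda>m. 0 < m \<and> (\<exists>l::int. bounded_order (g [^] (m::nat) \<otimes> c [^] l))"] that
      unfolding m_def by blast
    define x where "x = g [^] m \<otimes> c [^] l"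
    have xG: "x \<in> carrier G" unfolding x_def using g cG by simp
    have "x \<noteq> \<one>" if "\<not> p dvd m"
    proof
      assume "x = \<one>"
      then have "g [^] m = c [^] (- l)" unfolding x_def using g cG
        by (metis int_pow_closed int_pow_neg inv_equality inv_inv nat_pow_closed inv_closed)
      then have "g [^] m \<in> generate G {c}" unfolding gen by blast
      then show False using isolated_coprime_power[OF iso g(1) that] g(2) unfolding c_def by blast
    qed
    then obtain M1 where M1: "normal_p_index p G M1" "\<not> p dvd m \<Longrightarrow> x \<notin> M1"
      using residually_p[OF xG] normal_p_index_carrier by metis
    obtain M2 where M2: "normal_p_index p G M2" "\<And>k. \<exists>N. refines M2 N \<and> c [^] (p ^ k) \<notin> N"
      using hyperbolic_unbounded_order[OF w L] unfolding c_def by blast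
    define M where "M = M2 \<inter> M1"
    have M: "normal_p_index p G M" unfolding M_def by (rule normal_p_index_Int[OF p M2(1) M1(1)])
    have sM: "subgroup M G" using normal_imp_subgroup[OF normal_p_index_normal[OF M]] .
    have unb: "\<exists>N. refines M N \<and> c [^] (p ^ k) \<notin> N" for k
      using M2(2)[of k] refines_Int[OF _ M1(1)] unfolding M_def by blast
    obtain n where n: "\<And>N. refines M N \<Longrightarrow> x [^] (p ^ n) \<in> N"
      using l M unfolding bounded_order_def x_def by blast
    obtain e where e: "c [^] (p ^ e) \<in> M" using M cG unfolding normal_p_index_iff[OF p] by blast
    \<comment> \<open>Modulo \<open>N\<close> the order of \<open>x\<close> is at most \<open>p ^ n\<close>. The surplus \<open>e\<close> in the order of \<open>c\<close> forces a power
      of \<open>c\<close> congruent to \<open>x\<close> into \<open>M\<close>.\<close>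
    obtain N where N: "refines M N" and cN: "c [^] (p ^ (n + e)) \<notin> N" using unb by blast
    have npi: "normal_p_index p G N" and NM: "N \<subseteq> M" using N unfolding refines_def by blast+
    have sN: "subgroup N G" using normal_imp_subgroup[OF normal_p_index_normal[OF npi]] .
    have "g \<notin> generate G {c} <#> N"
    proof
      assume "g \<in> generate G {c} <#> N"
      then obtain i :: int and u where u: "u \<in> N" "g = c [^] i \<otimes> u" using memE by blast
      have uG: "u \<in> carrier G" using u(1) sN subgroup.mem_carrier by metis
      define j where "j = i * int m + l"
      have ui: "u = inv (c [^] i) \<otimes> g" using u(2) uG cG by (simp add: inv_mult_cancel)
      have uc: "u \<otimes> c = c \<otimes> u"
      proof -
        have "u \<otimes> c = inv (c [^] i) \<otimes> (c \<otimes> g)" unfolding ui using g cG comm by (simp add: m_assoc)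
        also have "\<dots> = (inv (c [^] i) \<otimes> c) \<otimes> g" using g cG by (simp add: m_assoc)
        also have "inv (c [^] i) \<otimes> c = c \<otimes> inv (c [^] i)"
          using commute_int_pow[OF cG cG HOL.refl, of "- i"] cG by (simp add: int_pow_neg)
        finally show ?thesis unfolding ui using g cG by (simp add: m_assoc)
      qed
      have "g [^] m = (c [^] i) [^] m \<otimes> u [^] m" unfolding u(2)
        using pow_mult_distrib[of "c [^] i" u m] commute_int_pow[OF uG cG uc, of i] cG uG by simp
      also have "(c [^] i) [^] m = c [^] (i * int m)"
        using cG int_pow_pow[of c i "int m"] by (simp add: int_pow_int mult.commute)
      also have "c [^] (i * int m) \<otimes> u [^] m = u [^] m \<otimes> c [^] (i * int m)"
        using commute_nat_pow[OF uG cG uc] by simp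
      finally have x: "x = u [^] m \<otimes> c [^] j"
        unfolding x_def j_def using cG uG by (simp add: int_pow_mult m_assoc)
      have um: "u [^] m \<in> N" using subgroup_nat_pow_closed[OF sN u(1)] .
      have "x [^] (p ^ n) = (u [^] m) [^] (p ^ n) \<otimes> (c [^] j) [^] (p ^ n)" unfolding x
        using pow_mult_distrib[of "u [^] m" "c [^] j" "p ^ n"] commute_nat_pow[OF uG cG uc] cG uG by simp
      then have "(c [^] j) [^] (p ^ n) = inv ((u [^] m) [^] (p ^ n)) \<otimes> x [^] (p ^ n)"
        using uG cG by (simp add: inv_mult_cancel)
      then have "(c [^] j) [^] (p ^ n) \<in> N"
        using subgroup.m_closed[OF sN subgroup.m_inv_closed[OF sN subgroup_nat_pow_closed[OF sN um]] n[OF N]]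
        by simp
      then have "c [^] (j * int (p ^ n)) \<in> N"
        using cG int_pow_pow[of c j "int (p ^ n)"] int_pow_int[of G "c [^] j" "p ^ n"]
        by (simp add: mult.commute)
      then have "int (p ^ Suc (n + e)) dvd j * int (p ^ n)"
        using dvd_exponent_if_pow_mem[OF p npi cG cN] by blast
      then have "int (p ^ n) * int (p ^ Suc e) dvd int (p ^ n) * j"
        by (simp add: power_add mult_ac)
      then have pj: "int (p ^ Suc e) dvd j" using prime_gt_0_nat[OF p] by simp
      show False
      proof (cases "p dvd m")
        case False
        obtain v where v: "j = int (p ^ e) * v" using pj by (metis dvdE dvd_trans le_imp_power_dvd le_SucI order_refl of_nat_dvd_iff)
        have "c [^] j = (c [^] (p ^ e)) [^] v" unfolding v using cG by (metis int_pow_int int_pow_pow mult.commute)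
        then have "c [^] j \<in> M" using subgroup_int_pow_closed[OF sM e] by simp
        then have "x \<in> M" unfolding x using um NM subgroup.m_closed[OF sM] by blast
        then show False using M1(2)[OF False] unfolding M_def by blast
      next
        case True
        then obtain k where k: "m = k * p" by (metis dvd_def mult.commute)
        have "int p dvd j" using pj by (metis dvd_mult_left of_nat_mult power_Suc)
        then have "int p dvd l" unfolding j_def k
          by (metis dvd_add_right_iff dvd_mult dvd_triv_right of_nat_mult)
        then obtain l' where l': "l = l' * int p" by (metis dvd_def mult.commute)
        define y where "y = g [^] k \<otimes> c [^] l'"
        have yG: "y \<in> carrier G" unfolding y_def using g cG by simp
        have "y [^] p = (g [^] k) [^] p \<otimes> (c [^] l') [^] p"
          unfolding y_def using pow_mult_distrib[of "g [^] k" "c [^] l'" p]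
            commute_nat_pow[OF g(1) cG comm] g cG by simp
        also have "(c [^] l') [^] p = c [^] l"
          unfolding l' using cG int_pow_pow[of c l' "int p"] by (simp add: int_pow_int mult.commute)
        also have "(g [^] k) [^] p = g [^] m" unfolding k using g by (simp add: nat_pow_pow)
        finally have "bounded_order y" using bounded_order_root[OF yG] l by simp
        moreover have "0 < k" "k < m" using m0 k prime_gt_1_nat[OF p] by auto
        ultimately show False using least unfolding y_def by blast
      qed
    qed
    then show ?thesis using npi unfolding c_def by blast
  qed
qed

end

section \<open>Conjugation\<close>

context group
begin

lemma conj_group_hom: "t \<in> carrier G \<Longrightarrow> group_hom G G (\<lambda>x. t \<otimes> x \<otimes> inv t)"
  unfolding group_hom_def group_hom_axioms_def
  by (auto intro!: homI simp: m_assoc inv_mult_cancel is_group)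

lemma generate_conj:
  assumes "t \<in> carrier G" "x \<in> carrier G"
  shows "generate G {t \<otimes> x \<otimes> inv t} = (\<lambda>y. t \<otimes> y \<otimes> inv t) ` generate G {x}"
  using group_hom.generate_img[OF conj_group_hom[OF assms(1)], of "{x}"] assms by simp

lemma conj_eq_iff:
  assumes "t \<in> carrier G" "x \<in> carrier G" "y \<in> carrier G"
  shows "t \<otimes> x \<otimes> inv t = t \<otimes> y \<otimes> inv t \<longleftrightarrow> x = y"
  using assms by simp

lemma conj_mem_iff:
  assumes "t \<in> carrier G" "F \<subseteq> carrier G" "g \<in> carrier G"
  shows "t \<otimes> g \<otimes> inv t \<in> (\<lambda>y. t \<otimes> y \<otimes> inv t) ` F \<longleftrightarrow> g \<in> F"
  using assms conj_eq_iff by (auto simp: subset_iff)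

lemma conj_notin_set_mult:
  assumes t: "t \<in> carrier G" and F: "F \<subseteq> carrier G" and N: "N \<lhd> G"
    and g: "t \<otimes> g \<otimes> inv t \<notin> (\<lambda>y. t \<otimes> y \<otimes> inv t) ` F <#> N"
  shows "g \<notin> F <#> N"
proof
  interpret N: normal N G by (rule N)
  assume "g \<in> F <#> N"
  then obtain f n where f: "f \<in> F" "n \<in> N" "g = f \<otimes> n" unfolding set_mult_def by blast
  have "t \<otimes> g \<otimes> inv t = (t \<otimes> f \<otimes> inv t) \<otimes> (t \<otimes> n \<otimes> inv t)"
    using f t F N.mem_carrier by (simp add: subset_iff m_assoc inv_mult_cancel)
  then show False using g f N.inv_op_closed2[OF t] unfolding set_mult_def by blast
qed

lemma p'_isolated_conj:
  assumes t: "t \<in> carrier G" and C: "p'_isolated p G C"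
  shows "p'_isolated p G ((\<lambda>y. t \<otimes> y \<otimes> inv t) ` C)"
  unfolding p'_isolated_def
proof (intro conjI ballI allI impI)
  have sC: "subgroup C G" using C unfolding p'_isolated_def by blast
  show "subgroup ((\<lambda>y. t \<otimes> y \<otimes> inv t) ` C) G"
    by (rule group_hom.subgroup_img_is_subgroup[OF conj_group_hom[OF t] sC])
  fix g and q :: nat
  assume g: "g \<in> carrier G" and q: "prime q \<and> q \<noteq> p \<and> g [^] q \<in> (\<lambda>y. t \<otimes> y \<otimes> inv t) ` C"
  define z where "z = inv t \<otimes> g \<otimes> t"
  have z: "z \<in> carrier G" "t \<otimes> z \<otimes> inv t = g"
  proof -
    have "t \<otimes> (inv t \<otimes> g) = g" using t g inv_mult_cancel[of "inv t" g] by simp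
    then show "t \<otimes> z \<otimes> inv t = g" unfolding z_def using t g by (simp add: m_assoc)
  qed (use t g in \<open>simp add: z_def\<close>)
  have "t \<otimes> (z [^] q) \<otimes> inv t \<in> (\<lambda>y. t \<otimes> y \<otimes> inv t) ` C"
    using q nat_pow_conj[OF t z(1)] z(2) by metis
  then have "z [^] q \<in> C" using conj_mem_iff[OF t subgroup.subset[OF sC]] z(1) by blast
  then have "z \<in> C" using C q z(1) unfolding p'_isolated_def by blast
  then show "g \<in> (\<lambda>y. t \<otimes> y \<otimes> inv t) ` C" using z(2) by blast
qed

end

section \<open>Filtrations induced on a factor\<close>

lemma separable_by_Omega:
  assumes hom: "group_hom X G \<iota>" and F: "F \<subseteq> carrier X"
    and sep: "separable_by X (Omega p G \<iota> X) F" and x: "x \<in> carrier X" "x \<notin> F"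
  shows "\<exists>N. normal_p_index p G N \<and> \<iota> x \<notin> \<iota> ` F <#>\<^bsub>G\<^esub> N"
proof -
  interpret hom: group_hom X G \<iota> by (rule hom)
  obtain N where N: "N \<lhd> G" "finite_p_index p G N" and xN: "x \<notin> F <#>\<^bsub>X\<^esub> {x \<in> carrier X. \<iota> x \<in> N}"
    using sep x unfolding separable_by_def Omega_def by blast
  have "\<iota> x \<notin> \<iota> ` F <#>\<^bsub>G\<^esub> N"
  proof
    assume "\<iota> x \<in> \<iota> ` F <#>\<^bsub>G\<^esub> N"
    then obtain f n where f: "f \<in> F" "n \<in> N" "\<iota> x = \<iota> f \<otimes>\<^bsub>G\<^esub> n" unfolding set_mult_def by blast
    have fX: "f \<in> carrier X" using f F by blast
    have nG: "n \<in> carrier G" using f N(1) normal_imp_subgroup subgroup.mem_carrier by metis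
    have "\<iota> (inv\<^bsub>X\<^esub> f \<otimes>\<^bsub>X\<^esub> x) = n" using f fX x nG by (simp add: hom.H.inv_mult_cancel)
    then have "inv\<^bsub>X\<^esub> f \<otimes>\<^bsub>X\<^esub> x \<in> {x \<in> carrier X. \<iota> x \<in> N}" using f fX x by simp
    moreover have "x = f \<otimes>\<^bsub>X\<^esub> (inv\<^bsub>X\<^esub> f \<otimes>\<^bsub>X\<^esub> x)"
      using fX x hom.G.inv_mult_cancel[of "inv\<^bsub>X\<^esub> f" x] by simp
    ultimately show False using xN f(1) unfolding set_mult_def by blast
  qed
  then show ?thesis using N unfolding normal_p_index_def by blast
qed

lemma filtration_residual:
  assumes "filtration X Y (Omega p G \<iota> X)" "x \<in> carrier X" "x \<noteq> \<one>\<^bsub>X\<^esub>"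
  shows "\<exists>N. normal_p_index p G N \<and> \<iota> x \<notin> N"
  using assms unfolding filtration_def Omega_def normal_p_index_def by blast

text \<open>A nontrivial element of the factor survives in some quotient of \<open>G\<close>.\<close>

lemma filtration_inj_on:
  assumes hom: "group_hom X G \<iota>" and fil: "filtration X Y (Omega p G \<iota> X)"
  shows "inj_on \<iota> (carrier X)"
proof -
  interpret hom: group_hom X G \<iota> by (rule hom)
  have "x = \<one>\<^bsub>X\<^esub>" if x: "x \<in> carrier X" "\<iota> x = \<one>\<^bsub>G\<^esub>" for x
  proof (rule ccontr)
    assume "x \<noteq> \<one>\<^bsub>X\<^esub>"
    then obtain N where "normal_p_index p G N" "\<iota> x \<notin> N" using filtration_residual[OF fil x(1)] by blast
    then show False
      using x normal_imp_subgroup subgroup.one_closed unfolding normal_p_index_def by metis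
  qed
  then show ?thesis using hom.inj_on_one_iff by blast
qed

text \<open>The conjugate of the cyclic subgroup is the image of a cyclic subgroup \<open>L\<close> of \<open>X\<close> that inherits
  \<open>p'\<close>-isolation and, not lying in \<open>\<Lambda>\<close>, is separable by \<open>\<Omega>\<close>. This handles the elements of the
  factor; the others are separated from the whole factor.\<close>

lemma separate_conjugate_into_factor:
  assumes hom: "group_hom X G \<iota>" and fil: "filtration X Y (Omega p G \<iota> X)"
    and vertex: "\<And>g. g \<in> carrier G \<Longrightarrow> g \<notin> \<iota> ` carrier X \<Longrightarrow>
      \<exists>N. normal_p_index p G N \<and> g \<notin> \<iota> ` carrier X <#>\<^bsub>G\<^esub> N"
    and x: "x \<in> carrier G" and iso: "p'_isolated p G (generate G {x})"
    and \<Lambda>: "\<forall>L \<in> Lambda p G \<iota> X. \<not> conjugate_in G (generate G {x}) (\<iota> ` L)"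
    and t: "t \<in> carrier G" and a: "a \<in> carrier X" "t \<otimes>\<^bsub>G\<^esub> x \<otimes>\<^bsub>G\<^esub> inv\<^bsub>G\<^esub> t = \<iota> a"
    and g: "g \<in> carrier G" "g \<notin> generate G {x}"
  shows "\<exists>N. normal_p_index p G N \<and> g \<notin> generate G {x} <#>\<^bsub>G\<^esub> N"
proof -
  interpret hom: group_hom X G \<iota> by (rule hom)
  let ?\<tau> = "\<lambda>y. t \<otimes>\<^bsub>G\<^esub> y \<otimes>\<^bsub>G\<^esub> inv\<^bsub>G\<^esub> t" and ?C = "generate G {x}"
  define L where "L = generate X {a}"
  have LX: "L \<subseteq> carrier X" unfolding L_def by (rule hom.G.generate_incl) (use a in simp)
  have CG: "?C \<subseteq> carrier G" by (rule hom.H.generate_incl) (use x in simp)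
  have L: "\<iota> ` L = ?\<tau> ` ?C"
    using hom.generate_img[of "{a}"] hom.H.generate_conj[OF t x] a unfolding L_def by simp
  have inj: "inj_on \<iota> (carrier X)" by (rule filtration_inj_on[OF hom fil])
  have "p'_isolated p X L" unfolding p'_isolated_def
  proof (intro conjI ballI allI impI)
    show "subgroup L X" unfolding L_def by (rule hom.G.generate_is_subgroup) (use a in simp)
    fix y and q :: nat
    assume y: "y \<in> carrier X" and q: "prime q \<and> q \<noteq> p \<and> y [^]\<^bsub>X\<^esub> q \<in> L"
    have "\<iota> y [^]\<^bsub>G\<^esub> q \<in> \<iota> ` L" using q hom.hom_nat_pow[OF y, of q] by (metis imageI)
    then have "\<iota> y \<in> \<iota> ` L"
      using hom.H.p'_isolated_conj[OF t iso] q hom.hom_closed[OF y] unfolding L p'_isolated_def by blast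
    then show "y \<in> L" using inj y LX by (auto dest: inj_onD)
  qed
  moreover have "cyclic_subgroup X L" unfolding cyclic_subgroup_def L_def using a by blast
  moreover have "conjugate_in G ?C (\<iota> ` L)"
    unfolding conjugate_in_def L
  proof (intro bexI[OF _ t])
    show "?\<tau> ` ?C = t <#\<^bsub>G\<^esub> (?C #>\<^bsub>G\<^esub> inv\<^bsub>G\<^esub> t)"
      unfolding l_coset_def r_coset_def using t CG by (auto simp: subset_iff hom.H.m_assoc image_iff)
  qed
  ultimately have sep: "separable_by X (Omega p G \<iota> X) L"
    using \<Lambda> unfolding Lambda_def by blast
  have \<tau>g: "?\<tau> g \<in> carrier G" "?\<tau> g \<notin> \<iota> ` L"
    unfolding L using hom.H.conj_mem_iff[OF t CG g(1)] t g by auto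
  have "\<exists>N. normal_p_index p G N \<and> ?\<tau> g \<notin> \<iota> ` L <#>\<^bsub>G\<^esub> N"
  proof (cases "?\<tau> g \<in> \<iota> ` carrier X")
    case True
    then obtain y where y: "y \<in> carrier X" "?\<tau> g = \<iota> y" by blast
    then show ?thesis using separable_by_Omega[OF hom LX sep y(1)] \<tau>g by auto
  next
    case False
    have "\<iota> ` L <#>\<^bsub>G\<^esub> N \<subseteq> \<iota> ` carrier X <#>\<^bsub>G\<^esub> N" for N
      using LX by (intro mono_set_mult) auto
    then show ?thesis using vertex[OF \<tau>g(1) False] by blast
  qed
  then show ?thesis
    unfolding L using hom.H.conj_notin_set_mult[OF t CG] unfolding normal_p_index_def by blast
qed

section \<open>The edge cocycle of a free product with amalgamation\<close>

locale amalgam_data = A: group A + B: group B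
  for A :: "('a, 'm) monoid_scheme" and B :: "('b, 'n) monoid_scheme" +
  fixes H :: "'a set" and K :: "'b set" and \<phi> :: "'a \<Rightarrow> 'b"
  assumes subgroup_H: "subgroup H A" and subgroup_K: "subgroup K B"
    and \<phi>: "\<phi> \<in> iso (A\<lparr>carrier := H\<rparr>) (B\<lparr>carrier := K\<rparr>)"
begin

abbreviation "words \<equiv> amalg_words A B"
abbreviation "eqv \<equiv> amalg_eq A B H \<phi>"
abbreviation "rel \<equiv> amalg_rel A B H \<phi>"
abbreviation "P \<equiv> amalg_product A B H \<phi>"
abbreviation "cls w \<equiv> rel `` {w}"

lemma \<phi>_image: "\<phi> ` H = K"
  using \<phi> by (simp add: iso_def bij_betw_def)

lemma words_simps [simp]:
  "[] \<in> words" "Inl a # w \<in> words \<longleftrightarrow> a \<in> carrier A \<and> w \<in> words"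
  "Inr b # w \<in> words \<longleftrightarrow> b \<in> carrier B \<and> w \<in> words"
  "v @ w \<in> words \<longleftrightarrow> v \<in> words \<and> w \<in> words"
  by (auto simp: amalg_words_def)

lemma eqv_words: "eqv v w \<Longrightarrow> v \<in> words \<and> w \<in> words"
proof (induction rule: amalg_eq.induct)
  case (amalg h)
  then show ?case
    using subgroup.mem_carrier[OF subgroup_H] subgroup.mem_carrier[OF subgroup_K] \<phi>_image by auto
qed auto

lemma equiv_rel: "equiv words rel"
proof (rule equivI)
  show "rel \<subseteq> words \<times> words" unfolding amalg_rel_def using eqv_words by auto
  show "refl_on words rel" unfolding refl_on_def amalg_rel_def using amalg_eq.refl by auto
  show "sym rel" unfolding sym_def amalg_rel_def using amalg_eq.sym by auto
  show "trans rel" unfolding trans_def amalg_rel_def using amalg_eq.trans by blast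
qed

lemma cls_eq: "eqv v w \<Longrightarrow> cls v = cls w"
  using equiv_class_eq[OF equiv_rel] by (simp add: amalg_rel_def)

lemma carrier_P: "carrier P = cls ` words"
  by (auto simp: amalg_product_def quotient_def)

lemma mult_cls:
  assumes "v \<in> words" "w \<in> words"
  shows "cls v \<otimes>\<^bsub>P\<^esub> cls w = cls (v @ w)"
proof -
  have "cls (x @ y) = cls (v @ w)" if "x \<in> cls v" "y \<in> cls w" for x y
    using that cls_eq amalg_eq.append amalg_eq.sym unfolding amalg_rel_def by blast
  moreover have "v \<in> cls v" "w \<in> cls w" using assms amalg_eq.refl unfolding amalg_rel_def by auto
  ultimately have "(\<Union>x\<in>cls v. \<Union>y\<in>cls w. cls (x @ y)) = cls (v @ w)" by blast
  then show ?thesis by (simp add: amalg_product_def)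
qed

lemma one_P: "\<one>\<^bsub>P\<^esub> = cls []"
  by (simp add: amalg_product_def)

lemma letter_inverse:
  assumes "[s] \<in> words"
  shows "\<exists>t. [t] \<in> words \<and> eqv [t, s] []"
proof (cases s)
  case (Inl a)
  then have "a \<in> carrier A" using assms by simp
  then show ?thesis
    using Inl amalg_eq.left_mult[of "inv\<^bsub>A\<^esub> a" A a B H \<phi>] amalg_eq.left_one[of A B H \<phi>] amalg_eq.trans
    by (intro exI[of _ "Inl (inv\<^bsub>A\<^esub> a)"]) auto
next
  case (Inr b)
  then have "b \<in> carrier B" using assms by simp
  then show ?thesis
    using Inr amalg_eq.right_mult[of "inv\<^bsub>B\<^esub> b" B b A H \<phi>] amalg_eq.right_one[of A B H \<phi>] amalg_eq.trans
    by (intro exI[of _ "Inr (inv\<^bsub>B\<^esub> b)"]) auto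
qed

lemma word_inverse: "w \<in> words \<Longrightarrow> \<exists>v\<in>words. eqv (v @ w) []"
proof (induction w)
  case Nil
  then show ?case using amalg_eq.refl[of "[]" A B H \<phi>] by (intro bexI[of _ "[]"]) auto
next
  case (Cons s w)
  have s: "[s] \<in> words" and w: "w \<in> words"
    using Cons.prems words_simps(4)[of "[s]" w] by auto
  obtain v where v: "v \<in> words" "eqv (v @ w) []" using Cons.IH[OF w] by blast
  obtain t where t: "[t] \<in> words" "eqv [t, s] []" using letter_inverse[OF s] by blast
  have "eqv (v @ ([t, s] @ w)) (v @ ([] @ w))"
    using t(2) v(1) w by (intro amalg_eq.append amalg_eq.refl) auto
  then have "eqv ((v @ [t]) @ s # w) []" using v(2) amalg_eq.trans by fastforce
  then show ?case using v t by (intro bexI[of _ "v @ [t]"]) auto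
qed

lemma group_P: "group P"
proof (rule groupI)
  fix x y assume "x \<in> carrier P" "y \<in> carrier P"
  then show "x \<otimes>\<^bsub>P\<^esub> y \<in> carrier P" unfolding carrier_P by (auto simp: mult_cls)
next
  fix x y z assume "x \<in> carrier P" "y \<in> carrier P" "z \<in> carrier P"
  then show "x \<otimes>\<^bsub>P\<^esub> y \<otimes>\<^bsub>P\<^esub> z = x \<otimes>\<^bsub>P\<^esub> (y \<otimes>\<^bsub>P\<^esub> z)" unfolding carrier_P by (auto simp: mult_cls)
next
  fix x assume "x \<in> carrier P"
  then obtain w where w: "w \<in> words" "x = cls w" unfolding carrier_P by blast
  then show "\<one>\<^bsub>P\<^esub> \<otimes>\<^bsub>P\<^esub> x = x" unfolding one_P by (simp add: mult_cls)
  obtain v where v: "v \<in> words" "eqv (v @ w) []" using word_inverse[OF w(1)] by blast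
  then have "cls v \<otimes>\<^bsub>P\<^esub> x = \<one>\<^bsub>P\<^esub>" unfolding one_P w(2) by (simp add: mult_cls w(1) cls_eq)
  then show "\<exists>y\<in>carrier P. y \<otimes>\<^bsub>P\<^esub> x = \<one>\<^bsub>P\<^esub>" using v(1) unfolding carrier_P by blast
qed (simp add: one_P carrier_P)

sublocale P: group P by (rule group_P)

lemma cls_carrier [simp]: "w \<in> words \<Longrightarrow> cls w \<in> carrier P"
  unfolding carrier_P by blast

abbreviation "\<alpha> \<equiv> amalg_inl A B H \<phi>"
abbreviation "\<beta> \<equiv> amalg_inr A B H \<phi>"

lemma hom_inl: "group_hom A P \<alpha>"
  unfolding group_hom_def group_hom_axioms_def amalg_inl_def
  using cls_eq[OF amalg_eq.left_mult]
  by (auto intro!: homI simp: A.is_group P.is_group mult_cls)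

lemma hom_inr: "group_hom B P \<beta>"
  unfolding group_hom_def group_hom_axioms_def amalg_inr_def
  using cls_eq[OF amalg_eq.right_mult]
  by (auto intro!: homI simp: B.is_group P.is_group mult_cls)

lemma inl_eq_inr: "h \<in> H \<Longrightarrow> \<alpha> h = \<beta> (\<phi> h)"
  unfolding amalg_inl_def amalg_inr_def by (rule cls_eq[OF amalg_eq.amalg])

lemma image_amalgamated: "\<alpha> ` H = \<beta> ` K"
  using inl_eq_inr \<phi>_image by force

definition factor :: "bool \<Rightarrow> ('a + 'b) list set set" where
  "factor b = (if b then \<alpha> ` carrier A else \<beta> ` carrier B)"

lemma letter_in_factor: "[s] \<in> words \<Longrightarrow> cls [s] \<in> factor (isl s)"
  by (cases s) (auto simp: factor_def amalg_inl_def amalg_inr_def)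

lemma factorE:
  assumes "y \<in> factor b"
  obtains s where "[s] \<in> words" "isl s = b" "y = cls [s]"
proof (cases b)
  case True
  then obtain a where "a \<in> carrier A" "y = cls [Inl a]"
    using assms by (auto simp: factor_def amalg_inl_def)
  then show thesis using that[of "Inl a"] True by simp
next
  case False
  then obtain a where "a \<in> carrier B" "y = cls [Inr a]"
    using assms by (auto simp: factor_def amalg_inr_def)
  then show thesis using that[of "Inr a"] False by simp
qed

lemma two_factors_P: "two_factors P (\<alpha> ` H) factor"
proof (intro two_factors.intro two_factors_axioms.intro group_P)
  interpret \<alpha>: group_hom A P \<alpha> by (rule hom_inl)
  interpret \<beta>: group_hom B P \<beta> by (rule hom_inr)
  show "subgroup (\<alpha> ` H) P" by (rule \<alpha>.subgroup_img_is_subgroup[OF subgroup_H])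
  show "subgroup (factor b) P" for b
    unfolding factor_def using \<alpha>.img_is_subgroup \<beta>.img_is_subgroup by simp
  show "\<alpha> ` H \<subseteq> factor b" for b
    using image_mono[OF subgroup.subset[OF subgroup_H], of \<alpha>]
      image_mono[OF subgroup.subset[OF subgroup_K], of \<beta>] image_amalgamated
    unfolding factor_def by simp
  show "Q g" if g: "g \<in> carrier P" and one: "Q \<one>\<^bsub>P\<^esub>"
    and step: "\<And>g b y. g \<in> carrier P \<Longrightarrow> Q g \<Longrightarrow> y \<in> factor b \<Longrightarrow> Q (g \<otimes>\<^bsub>P\<^esub> y)" for Q g
  proof -
    have "Q (cls w)" if "w \<in> words" for w
      using that
    proof (induction w rule: rev_induct)
      case (snoc s w)
      then have "Q (cls w \<otimes>\<^bsub>P\<^esub> cls [s])" by (intro step[OF _ _ letter_in_factor]) auto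
      then show ?case using snoc.prems by (simp add: mult_cls)
    qed (use one one_P in simp)
    then show ?thesis using g unfolding carrier_P by blast
  qed
qed

sublocale P: two_factors P "\<alpha> ` H" factor by (rule two_factors_P)

text \<open>The cocycle, computed along a word. It respects the defining relations: products telescope, and
  a letter from \<open>H\<close> fixes every \<open>E\<close> that contains \<open>H\<close>.\<close>

primrec walk :: "('a + 'b) list set set \<Rightarrow> bool \<Rightarrow> ('a + 'b) list \<Rightarrow> ('a + 'b) list set \<Rightarrow> int" where
  "walk E b [] x = 0"
| "walk E b (s # w) x =
    of_bool (isl s \<noteq> b) * (of_bool (x \<in> E) - of_bool (inv\<^bsub>P\<^esub> (cls [s]) \<otimes>\<^bsub>P\<^esub> x \<in> E)) +
    walk E b w (inv\<^bsub>P\<^esub> (cls [s]) \<otimes>\<^bsub>P\<^esub> x)"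

lemma walk_append:
  "v \<in> words \<Longrightarrow> w \<in> words \<Longrightarrow> x \<in> carrier P \<Longrightarrow>
    walk E b (v @ w) x = walk E b v x + walk E b w (inv\<^bsub>P\<^esub> (cls v) \<otimes>\<^bsub>P\<^esub> x)"
proof (induction v arbitrary: x)
  case Nil
  then show ?case using one_P by (metis P.inv_one P.l_one add_0 append_Nil walk.simps(1))
next
  case (Cons s v)
  have s: "[s] \<in> words" and v: "v \<in> words"
    using Cons.prems words_simps(4)[of "[s]" v] by auto
  have "cls (s # v) = cls [s] \<otimes>\<^bsub>P\<^esub> cls v" using mult_cls[OF s v] by simp
  then have "inv\<^bsub>P\<^esub> (cls (s # v)) \<otimes>\<^bsub>P\<^esub> x = inv\<^bsub>P\<^esub> (cls v) \<otimes>\<^bsub>P\<^esub> (inv\<^bsub>P\<^esub> (cls [s]) \<otimes>\<^bsub>P\<^esub> x)"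
    using s v Cons.prems by (simp add: P.inv_mult_group P.m_assoc)
  then show ?case using Cons.IH[OF v Cons.prems(2), of "inv\<^bsub>P\<^esub> (cls [s]) \<otimes>\<^bsub>P\<^esub> x"] s Cons.prems by simp
qed

lemma walk_eqv:
  assumes E: "subgroup E P" "\<alpha> ` H \<subseteq> E" and "eqv v w"
  shows "x \<in> carrier P \<Longrightarrow> walk E b v x = walk E b w x"
  using \<open>eqv v w\<close>
proof (induction arbitrary: x rule: amalg_eq.induct)
  case (append v v' w w')
  then show ?case
    using eqv_words[OF append.hyps(1)] eqv_words[OF append.hyps(2)] cls_eq[OF append.hyps(1)]
    by (simp add: walk_append)
next
  case (left_mult a a')
  have "cls [Inl (a \<otimes>\<^bsub>A\<^esub> a')] = cls [Inl a] \<otimes>\<^bsub>P\<^esub> cls [Inl a']"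
    using left_mult cls_eq[OF amalg_eq.left_mult[of a A a' B H \<phi>]] by (simp add: mult_cls)
  then show ?case using left_mult by (simp add: P.inv_mult_group P.m_assoc algebra_simps)
next
  case left_one
  have "cls [Inl \<one>\<^bsub>A\<^esub>] = \<one>\<^bsub>P\<^esub>" using cls_eq[OF amalg_eq.left_one] one_P by simp
  then show ?case using left_one by simp
next
  case (right_mult a a')
  have "cls [Inr (a \<otimes>\<^bsub>B\<^esub> a')] = cls [Inr a] \<otimes>\<^bsub>P\<^esub> cls [Inr a']"
    using right_mult cls_eq[OF amalg_eq.right_mult[of a B a' A H \<phi>]] by (simp add: mult_cls)
  then show ?case using right_mult by (simp add: P.inv_mult_group P.m_assoc algebra_simps)
next
  case right_one
  have "cls [Inr \<one>\<^bsub>B\<^esub>] = \<one>\<^bsub>P\<^esub>" using cls_eq[OF amalg_eq.right_one] one_P by simp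
  then show ?case using right_one by simp
next
  case (amalg h)
  have c: "cls [Inl h] = \<alpha> h" "cls [Inr (\<phi> h)] = \<alpha> h"
    using inl_eq_inr[OF amalg(1)] by (auto simp: amalg_inl_def amalg_inr_def)
  have hE: "\<alpha> h \<in> E" using amalg E by blast
  have "inv\<^bsub>P\<^esub> (\<alpha> h) \<otimes>\<^bsub>P\<^esub> x \<in> E \<longleftrightarrow> x \<in> E"
  proof
    have hP: "\<alpha> h \<in> carrier P" using hE subgroup.mem_carrier[OF E(1)] by blast
    assume "inv\<^bsub>P\<^esub> (\<alpha> h) \<otimes>\<^bsub>P\<^esub> x \<in> E"
    then have "\<alpha> h \<otimes>\<^bsub>P\<^esub> (inv\<^bsub>P\<^esub> (\<alpha> h) \<otimes>\<^bsub>P\<^esub> x) \<in> E" by (rule subgroup.m_closed[OF E(1) hE])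
    then show "x \<in> E" using hP amalg.prems P.inv_mult_cancel[of "inv\<^bsub>P\<^esub> (\<alpha> h)" x] by simp
  qed (use subgroup.m_closed[OF E(1)] subgroup.m_inv_closed[OF E(1)] hE in blast)
  then show ?case using c by simp
qed auto

lemma edge_cocycle_P:
  assumes E: "subgroup E P" "\<alpha> ` H \<subseteq> E"
  shows "\<exists>\<delta>. P.edge_cocycle E b \<delta>"
proof -
  define \<delta> where "\<delta> g = walk E b (SOME w. w \<in> words \<and> cls w = g)" for g
  have \<delta>: "\<delta> (cls w) x = walk E b w x" if w: "w \<in> words" and x: "x \<in> carrier P" for w x
  proof -
    let ?v = "SOME v. v \<in> words \<and> cls v = cls w"
    have v: "?v \<in> words \<and> cls ?v = cls w" by (rule someI[of _ w]) (use w in simp)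
    then have "(?v, w) \<in> rel" using eq_equiv_class[OF _ equiv_rel w] by blast
    then show ?thesis unfolding \<delta>_def using walk_eqv[OF E _ x] by (simp add: amalg_rel_def)
  qed
  have "\<delta> (g \<otimes>\<^bsub>P\<^esub> h) x = \<delta> g x + \<delta> h (inv\<^bsub>P\<^esub> g \<otimes>\<^bsub>P\<^esub> x)"
    if gh: "g \<in> carrier P" "h \<in> carrier P" and x: "x \<in> carrier P" for g h x
  proof -
    obtain v w where v: "v \<in> words" "g = cls v" and w: "w \<in> words" "h = cls w"
      using gh unfolding carrier_P by blast
    have "inv\<^bsub>P\<^esub> (cls v) \<otimes>\<^bsub>P\<^esub> x \<in> carrier P" using v x by simp
    then show ?thesis using v w x by (simp add: mult_cls \<delta> walk_append)
  qed
  moreover have "\<delta> y x = of_bool (c \<noteq> b) * (of_bool (x \<in> E) - of_bool (inv\<^bsub>P\<^esub> y \<otimes>\<^bsub>P\<^esub> x \<in> E))"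
    if y: "y \<in> factor c" and x: "x \<in> carrier P" for c y x
  proof -
    obtain s where s: "[s] \<in> words" "isl s = c" "y = cls [s]" using factorE[OF y] by blast
    show ?thesis unfolding s(3) \<delta>[OF s(1) x] using s(2) by simp
  qed
  ultimately have "P.edge_cocycle E b \<delta>" unfolding P.edge_cocycle_def by blast
  then show ?thesis by blast
qed

lemma filtered_amalgam_P:
  assumes p: "prime p"
    and filA: "filtration A H (Omega p P \<alpha> A)" and filB: "filtration B K (Omega p P \<beta> B)"
  shows "filtered_amalgam P (\<alpha> ` H) factor p"
proof (unfold_locales)
  show "prime p" by (rule p)
  show "\<exists>\<delta>. P.edge_cocycle E b \<delta>" if "subgroup E P" "\<alpha> ` H \<subseteq> E" for E b
    by (rule edge_cocycle_P[OF that])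
  interpret \<alpha>: group_hom A P \<alpha> by (rule hom_inl)
  interpret \<beta>: group_hom B P \<beta> by (rule hom_inr)
  show "\<exists>N. normal_p_index p P N \<and> x \<notin> N" if x: "x \<in> factor b" and ne: "x \<noteq> \<one>\<^bsub>P\<^esub>" for x b
  proof (cases b)
    case True
    then obtain a where a: "a \<in> carrier A" "x = \<alpha> a" using x unfolding factor_def by auto
    then show ?thesis using filtration_residual[OF filA a(1)] ne \<alpha>.hom_one by metis
  next
    case False
    then obtain a where a: "a \<in> carrier B" "x = \<beta> a" using x unfolding factor_def by auto
    then show ?thesis using filtration_residual[OF filB a(1)] ne \<beta>.hom_one by metis
  qed
  show "\<exists>N. normal_p_index p P N \<and> x \<notin> \<alpha> ` H <#>\<^bsub>P\<^esub> N" if x: "x \<in> factor b" "x \<notin> \<alpha> ` H" for x b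
  proof (cases b)
    case True
    then obtain a where a: "a \<in> carrier A" "x = \<alpha> a" using x unfolding factor_def by auto
    then show ?thesis using separable_by_Omega[OF hom_inl subgroup.subset[OF subgroup_H]] filA x
      unfolding filtration_def by blast
  next
    case False
    then obtain a where a: "a \<in> carrier B" "x = \<beta> a" using x unfolding factor_def by auto
    then show ?thesis using separable_by_Omega[OF hom_inr subgroup.subset[OF subgroup_K]] filB x
      unfolding filtration_def image_amalgamated by blast
  qed
qed

end

section \<open>Separability of cyclic subgroups\<close>

theorem theorem1p6:
  fixes p :: nat
    and A :: "('a, 'm) monoid_scheme" and B :: "('b, 'n) monoid_scheme"
    and H :: "'a set" and K :: "'b set" and \<phi> :: "'a \<Rightarrow> 'b"
    and G :: "('a + 'b) list set monoid"
    and \<alpha> :: "'a \<Rightarrow> ('a + 'b) list set" and \<beta> :: "'b \<Rightarrow> ('a + 'b) list set"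
    and C :: "('a + 'b) list set set"
  assumes "prime p"
    and "group A" and "group B" and "subgroup H A" and "subgroup K B"
    and "\<phi> \<in> iso (A\<lparr>carrier := H\<rparr>) (B\<lparr>carrier := K\<rparr>)"
    and "G = amalg_product A B H \<phi>"
    and "\<alpha> = amalg_inl A B H \<phi>" and "\<beta> = amalg_inr A B H \<phi>"
    and "filtration A H (Omega p G \<alpha> A)"
    and "filtration B K (Omega p G \<beta> B)"
    and "cyclic_subgroup G C" and "p'_isolated p G C"
    and "\<forall>L \<in> Lambda p G \<alpha> A. \<not> conjugate_in G C (\<alpha> ` L)"
    and "\<forall>L \<in> Lambda p G \<beta> B. \<not> conjugate_in G C (\<beta> ` L)"
  shows "p_separable p G C"
proof -
  interpret D: amalgam_data A B H K \<phi>
    using assms(2-6) by (simp add: amalgam_data_def amalgam_data_axioms_def)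
  note defs = assms(7-9)
  have filA: "filtration A H (Omega p G \<alpha> A)" and filB: "filtration B K (Omega p G \<beta> B)"
    using assms(10,11) .
  have "filtered_amalgam G (\<alpha> ` H) D.factor p"
    unfolding defs by (rule D.filtered_amalgam_P[OF assms(1)]) (use filA filB defs in simp_all)
  then interpret G: filtered_amalgam G "\<alpha> ` H" D.factor p .
  have factor: "D.factor True = \<alpha> ` carrier A" "D.factor False = \<beta> ` carrier B"
    by (simp_all add: D.factor_def defs)
  obtain x where x: "x \<in> carrier G" and C: "C = generate G {x}"
    using assms(12) unfolding cyclic_subgroup_def by blast
  note iso = assms(13)[unfolded C]
  have CG: "generate G {x} \<subseteq> carrier G" by (rule G.generate_incl) (use x in simp)
  show ?thesis
  proof (rule G.p_separableI)
    show "subgroup C G" using assms(13) unfolding p'_isolated_def by blast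
    fix g assume g: "g \<in> carrier G" "g \<notin> C"
    from x show "\<exists>N. normal_p_index p G N \<and> g \<notin> C <#>\<^bsub>G\<^esub> N"
    proof (rule G.conjugate_cyclically_reduced)
      fix t b assume t: "t \<in> carrier G" and tx: "t \<otimes>\<^bsub>G\<^esub> x \<otimes>\<^bsub>G\<^esub> inv\<^bsub>G\<^esub> t \<in> D.factor b"
      show ?thesis
      proof (cases b)
        case True
        then obtain a where a: "a \<in> carrier A" "t \<otimes>\<^bsub>G\<^esub> x \<otimes>\<^bsub>G\<^esub> inv\<^bsub>G\<^esub> t = \<alpha> a"
          using tx factor by auto
        show ?thesis unfolding C
          by (rule separate_conjugate_into_factor[OF _ filA _ x iso _ t a])
            (use D.hom_inl G.separate_from_factor[of _ True] factor assms(14) g C defs in auto)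
      next
        case False
        then obtain a where a: "a \<in> carrier B" "t \<otimes>\<^bsub>G\<^esub> x \<otimes>\<^bsub>G\<^esub> inv\<^bsub>G\<^esub> t = \<beta> a"
          using tx factor by auto
        show ?thesis unfolding C
          by (rule separate_conjugate_into_factor[OF _ filB _ x iso _ t a])
            (use D.hom_inr G.separate_from_factor[of _ False] factor assms(15) g C defs in auto)
      qed
    next
      fix t b w r
      assume t: "t \<in> carrier G" and r: "0 < r" "even r" and w: "G.reduced (\<alpha> ` H) b w r"
        and tx: "t \<otimes>\<^bsub>G\<^esub> x \<otimes>\<^bsub>G\<^esub> inv\<^bsub>G\<^esub> t = G.word_prod w r"
      let ?\<tau> = "\<lambda>y. t \<otimes>\<^bsub>G\<^esub> y \<otimes>\<^bsub>G\<^esub> inv\<^bsub>G\<^esub> t"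
      have gen: "generate G {G.word_prod w r} = ?\<tau> ` generate G {x}"
        using G.generate_conj[OF t x] tx by simp
      have "?\<tau> g \<in> carrier G" "?\<tau> g \<notin> generate G {G.word_prod w r}"
        unfolding gen using G.conj_mem_iff[OF t CG g(1)] t g C by auto
      then obtain N where "normal_p_index p G N" "?\<tau> g \<notin> generate G {G.word_prod w r} <#>\<^bsub>G\<^esub> N"
        using G.separate_from_cyclically_reduced[OF w r(2,1)] G.p'_isolated_conj[OF t iso]
        unfolding gen by blast
      then show ?thesis
        unfolding C gen using G.conj_notin_set_mult[OF t CG] unfolding normal_p_index_def by blast
    qed
  qed
qed

end
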